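(* Let $\psi:\mathbb{R}\to\mathbb{R}$ be a $C^\infty$ function such that $\lim_{x\to+\infty}\psi(x)=+\infty$ and, for some real $k>0$, $\psi'(x)\ge(\psi(x))^k$ for every $x$ large enough. Let $\omega$ and $\sigma$ be two strong weights such that $\omega(t^{\frac{1}{k+1}})=o(\sigma(t))$ as $t\to\infty$. Then there exists $f\in\mathcal{S}_{(\omega)}(\mathbb{R})$ such that $f\circ\psi\notin\mathcal{S}_{(\sigma)}(\mathbb{R})$.
   Context: A weight is a continuous (weakly) increasing function $\omega:[0,\infty)\to[0,\infty)$ such that: $(\alpha)$ there is $K\ge 1$ with $\omega(2t)\le K(\omega(t)+1)$ for all $t\ge 0$; $(\beta)$ $\int_0^\infty \frac{\omega(t)}{1+t^2}\,dt<\infty$; $(\gamma)$ $\log(1+t^2)=o(\omega(t))$ as $t\to\infty$; $(\delta)$ $\varphi_\omega(t):=\omega(e^t)$ is convex on $\mathbb{R}$. It is extended to $\mathbb{R}$ by $\omega(x)=\omega(|x|)$. The weight is strong if moreover $(\varepsilon)$ there is $C\ge 1$ with $\int_1^\infty \frac{\omega(yt)}{t^2}\,dt\le C\omega(y)+C$ for all $y>0$. For a weight $\omega$, the Gelfand-Shilov space $\mathcal{S}_{(\omega)}(\mathbb{R})$ consists of the (complex-valued) functions $f\in L^1(\mathbb{R})$ such that $f,\widehat f\in C^\infty(\mathbb{R})$ ($\widehat f$ the Fourier transform) and, for all $\lambda>0$ and $j\in\mathbb{N}_0$, $q_{\lambda,j}(f):=\max\big(\sup_{x\in\mathbb{R}}|f^{(j)}(x)|e^{\lambda\omega(x)},\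 \sup_{\xi\in\mathbb{R}}|\widehat f^{(j)}(\xi)|e^{\lambda\omega(\xi)}\big)<\infty$. It is a Fréchet space with these seminorms. With the Young conjugate $\varphi_\omega^*(s):=\sup\{st-\varphi_\omega(t): t\ge 0\}$, $s\ge 0$, equivalent systems of seminorms (defining the same space and topology) are $p_\lambda(f)=\sup_{j,k\in\mathbb{N}_0}\sup_{x}|x^kf^{(j)}(x)|e^{-\lambda\varphi_\omega^*(\frac{j+k}{\lambda})}$, $\lambda>0$, and $\pi_{\lambda,\mu}(f)=\sup_{j\in\mathbb{N}_0}\sup_{x}|f^{(j)}(x)|e^{-\lambda\varphi_\omega^*(\frac{j}{\lambda})+\mu\omega(x)}$, $\lambda,\mu>0$. *)

theory Defs
  imports "HOL-Analysis.Analysis" "HOL-Library.Landau_Symbols"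
begin

text \<open>A weight is defined on \<open>[0,\<infinity>)\<close>; here it is a function on all reals whose values at
  negative arguments are irrelevant. Its even extension is written out as \<open>\<omega> \<bar>x\<bar>\<close>.\<close>

definition weight :: "(real \<Rightarrow> real) \<Rightarrow> bool" where
  "weight \<omega> \<longleftrightarrow>
     continuous_on {0..} \<omega> \<and> mono_on {0..} \<omega> \<and> (\<forall>t\<ge>0. 0 \<le> \<omega> t) \<and>
     (\<exists>K\<ge>1. \<forall>t\<ge>0. \<omega> (2 * t) \<le> K * (\<omega> t + 1)) \<and>
     set_integrable lborel {0..} (\<lambda>t. \<omega> t / (1 + t\<^sup>2)) \<and>
     (\<lambda>t. ln (1 + t\<^sup>2)) \<in> o[at_top](\<omega>) \<and>
     convex_on UNIV (\<lambda>t. \<omega> (exp t))"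

text \<open>The integral is taken in \<open>[0,\<infinity>]\<close>, so the bound includes its convergence.\<close>

definition strong_weight :: "(real \<Rightarrow> real) \<Rightarrow> bool" where
  "strong_weight \<omega> \<longleftrightarrow> weight \<omega> \<and>
     (\<exists>C\<ge>1. \<forall>y>0. (\<integral>\<^sup>+ t\<in>{1..}. ennreal (\<omega> (y * t) / t\<^sup>2) \<partial>lborel) \<le> ennreal (C * \<omega> y + C))"

definition iter_deriv :: "nat \<Rightarrow> (real \<Rightarrow> 'a::real_normed_vector) \<Rightarrow> real \<Rightarrow> 'a" where
  "iter_deriv j f = ((\<lambda>g x. vector_derivative g (at x)) ^^ j) f"

definition C_infinity :: "(real \<Rightarrow> 'a::real_normed_vector) \<Rightarrow> bool" where
  "C_infinity f \<longleftrightarrow> (\<forall>j x. iter_deriv j f differentiable (at x))"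

text \<open>The normalization of the Fourier transform does not affect the space below: by the
  doubling condition on \<open>\<omega>\<close>, rescaling the frequency only changes the parameter \<open>l\<close> of the seminorms.\<close>

definition fourier :: "(real \<Rightarrow> complex) \<Rightarrow> real \<Rightarrow> complex" where
  "fourier f \<xi> = (LINT x|lborel. f x * exp (- \<i> * of_real (x * \<xi>)))"

definition gs_seminorm ::
  "(real \<Rightarrow> real) \<Rightarrow> real \<Rightarrow> nat \<Rightarrow> (real \<Rightarrow> complex) \<Rightarrow> ennreal" where
  "gs_seminorm \<omega> l j f =
     max (SUP x. ennreal (norm (iter_deriv j f x) * exp (l * \<omega> \<bar>x\<bar>)))
         (SUP \<xi>. ennreal (norm (iter_deriv j (fourier f) \<xi>) * exp (l * \<omega> \<bar>\<xi>\<bar>)))"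

definition gelfand_shilov :: "(real \<Rightarrow> real) \<Rightarrow> (real \<Rightarrow> complex) set" where
  "gelfand_shilov \<omega> =
     {f. integrable lborel f \<and> C_infinity f \<and> C_infinity (fourier f) \<and>
         (\<forall>l>0. \<forall>j. gs_seminorm \<omega> l j f < \<infinity>)}"

end

theory Submission
  imports Defs
    "HOL-Probability.Characteristic_Functions"
    "HOL-Probability.Sinc_Integral"
    "HOL-Complex_Analysis.Cauchy_Integral_Formula"
    "HOL-Real_Asymp.Real_Asymp"
begin

text \<open>The function is \<open>f x = (\<Sum>n. exp (- n M\<^sub>n) exp (- (M\<^sub>n / t\<^sub>n\<^sup>2) x\<^sup>2 + \<i> t\<^sub>n x))\<close> with
  \<open>M\<^sub>n = \<omega> t\<^sub>n + 1\<close> and a very sparse sequence \<open>t\<^sub>n\<close>. A strong weight satisfies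
  \<open>\<omega> x \<le> C M\<^sub>n (1 + x / t\<^sub>n)\<close>, so every seminorm of the \<open>n\<close>-th modulated Gaussian is at most
  \<open>exp (B M\<^sub>n)\<close> with \<open>B\<close> independent of \<open>n\<close>, and the factor \<open>exp (- n M\<^sub>n)\<close> puts \<open>f\<close> into the space
  of \<open>\<omega>\<close>. On \<open>[t\<^sub>n, 2 t\<^sub>n]\<close> the \<open>n\<close>-th summand dominates: \<open>Re f\<close> changes sign about \<open>t\<^sub>n\<^sup>2\<close> times, at
  distances \<open>\<pi> / t\<^sub>n\<close>, with amplitude at least \<open>exp (- (n + 4) M\<^sub>n) / 2\<close>. As \<open>\<psi>' \<ge> t\<^sub>n\<^sup>k\<close> there, an interval
  of length \<open>m \<pi> / t\<^sub>n\<^bsup>k+1\<^esup>\<close> contains \<open>m\<close> zeros of \<open>G = Re (f \<circ> \<psi>)\<close>, and the interpolation error estimate bounds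
  the amplitude by \<open>R\<^bsup>-m\<^esup> sup \<bar>G\<^bsup>(m)\<^esup>\<bar>\<close>, where \<open>R = t\<^sub>n\<^bsup>k+1\<^esup> / 16\<close> and \<open>m\<close> is of order \<open>t\<^sub>n\<^sup>2\<close> at most. If
  \<open>f \<circ> \<psi>\<close> were in the space of \<open>\<sigma>\<close>, Fourier inversion would give an \<open>m\<close> for which this is at most
  \<open>K exp (- \<sigma> R)\<close>, which is too small because \<open>\<omega> t = o(\<sigma> (t\<^bsup>k+1\<^esup>))\<close>. The argument needs \<open>k \<le> 1\<close>; for \<open>k > 1\<close>
  the differential inequality forces blow-up in finite time.\<close>

section \<open>Gaussians and Fourier inversion\<close>

lemma integrable_gaussian:
  fixes a :: real
  assumes "a > 0"
  shows "integrable lborel (\<lambda>x::real. exp (- a * x\<^sup>2))"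
proof -
  have "integrable lborel (\<lambda>x. sqrt (2 * pi) * std_normal_density x)"
    using integrable_std_normal_moment[of 0] by simp
  then have "integrable lborel (\<lambda>x::real. exp (- x\<^sup>2 / 2))"
    by (simp add: std_normal_density_def)
  from lborel_integrable_real_affine[OF this, of "sqrt (2 * a)" 0] show ?thesis
    using assms by (simp add: power_mult_distrib)
qed

text \<open>The product form is the one that simp produces when it splits
  \<open>of_real (x * y)\<close>.\<close>

lemma norm_iexp_mult [simp]: "norm (exp (\<i> * (complex_of_real x * complex_of_real y))) = 1"
  "norm (exp (\<i> * complex_of_real x)) = 1"
  by (simp_all flip: of_real_mult)

text \<open>The characteristic function of the standard normal distribution, rescaled: substituting
  \<open>c * x\<close> with \<open>c = 1 / sqrt (2 * a)\<close> turns \<open>a * x\<^sup>2\<close>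
  into \<open>x\<^sup>2 / 2\<close>.\<close>

lemma gaussian_fourier:
  fixes a b :: real
  assumes "a > 0"
  shows "(LINT x|lborel. of_real (exp (- a * x\<^sup>2)) * iexp (b * x))
    = complex_of_real (sqrt (pi / a) * exp (- b\<^sup>2 / (4 * a)))"
proof -
  define c where "c = 1 / sqrt (2 * a)"
  have c: "c > 0" "c\<^sup>2 = 1 / (2 * a)" using assms by (auto simp: c_def power_divide)
  have "char std_normal_distribution (b * c)
      = (LINT x|lborel. std_normal_density x *\<^sub>R iexp (b * c * x))"
    unfolding char_def by (subst integral_density) auto
  also have "\<dots> = (LINT x|lborel. (1 / sqrt (2 * pi)) *\<^sub>R (of_real (exp (- x\<^sup>2 / 2)) * iexp (b * c * x)))"
    by (intro Bochner_Integration.integral_cong) (auto simp: std_normal_density_def scaleR_conv_of_real)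
  finally have "sqrt (2 * pi) *\<^sub>R char std_normal_distribution (b * c)
      = (LINT x|lborel. of_real (exp (- x\<^sup>2 / 2)) * iexp (b * c * x))"
    by (subst (asm) integral_scaleR_right) simp
  moreover have "(LINT x|lborel. of_real (exp (- a * x\<^sup>2)) * iexp (b * x))
      = c *\<^sub>R (LINT x|lborel. of_real (exp (- x\<^sup>2 / 2)) * iexp (b * c * x))"
  proof -
    have "- a * (0 + c * x)\<^sup>2 = - x\<^sup>2 / 2" for x
      using c assms by (simp add: power_mult_distrib)
    then show ?thesis
      using c lborel_integral_real_affine[of c "\<lambda>x. of_real (exp (- a * x\<^sup>2)) * iexp (b * x)" 0]
      by (simp only: abs_of_pos add_0 mult.assoc)
  qed
  ultimately have "(LINT x|lborel. of_real (exp (- a * x\<^sup>2)) * iexp (b * x))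
      = (c * sqrt (2 * pi)) *\<^sub>R char std_normal_distribution (b * c)"
    by (simp only: scaleR_scaleR flip: scaleR_scaleR)
  moreover have "c * sqrt (2 * pi) = sqrt (pi / a)"
    using assms by (simp add: c_def real_sqrt_mult real_sqrt_divide field_simps)
  moreover have "(b * c)\<^sup>2 / 2 = b\<^sup>2 / (4 * a)" using c by (simp add: power_mult_distrib)
  ultimately show ?thesis
    by (simp add: char_std_normal_distribution scaleR_conv_of_real)
qed

lemma gaussian_integral:
  assumes "a > (0::real)"
  shows "(LINT x|lborel. exp (- a * x\<^sup>2)) = sqrt (pi / a)"
proof -
  have "complex_of_real (LINT x|lborel. exp (- a * x\<^sup>2)) = complex_of_real (sqrt (pi / a))"
    unfolding integral_complex_of_real[symmetric] using gaussian_fourier[OF assms, of 0] by simp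
  then show ?thesis by (simp only: of_real_eq_iff)
qed

text \<open>Gaussian summability: multiply the transform by \<open>exp (- \<epsilon> \<xi>\<^sup>2)\<close>, exchange the integrals and
  let \<open>\<epsilon>\<close> tend to \<open>0\<close>.\<close>

lemma fourier_inversion:
  fixes g :: "real \<Rightarrow> complex"
  assumes g: "integrable lborel g" and cont: "continuous_on UNIV g"
    and bdd: "\<And>x. norm (g x) \<le> B"
    and int: "integrable lborel (fourier g)"
  shows "g x = (LINT \<xi>|lborel. fourier g \<xi> * iexp (\<xi> * x)) / (2 * pi)"
proof -
  \<comment> \<open>With this value the transform of \<open>exp (- e n * \<xi>\<^sup>2)\<close> is,
    up to a factor, the Gaussian \<open>exp (- (x - y)\<^sup>2 / (4 * e n))\<close> of standard
    deviation \<open>1 / Suc n\<close>.\<close>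
  define e where "e n = 1 / (2 * real (Suc n)^2)" for n
  have e0: "e n > 0" for n by (simp add: e_def)
  have [measurable]: "g \<in> borel_measurable borel" "fourier g \<in> borel_measurable borel"
    using g int by (auto dest: borel_measurable_integrable)
  have e_lim: "e \<longlonglongrightarrow> 0"
  proof -
    have "(\<lambda>n. (1/2) * (inverse (real (Suc n)) * inverse (real (Suc n)))) \<longlonglongrightarrow> (1/2) * (0 * 0)"
      by (intro tendsto_intros LIMSEQ_inverse_real_of_nat)
    moreover have "e = (\<lambda>n. (1/2) * (inverse (real (Suc n)) * inverse (real (Suc n))))"
      by (auto simp: e_def power2_eq_square field_simps simp del: of_nat_Suc)
    ultimately show ?thesis by simp
  qed
  have lhs: "(\<lambda>n. LINT \<xi>|lborel. of_real (exp (- e n * \<xi>\<^sup>2)) * (fourier g \<xi> * iexp (\<xi> * x)))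
      \<longlonglongrightarrow> (LINT \<xi>|lborel. fourier g \<xi> * iexp (\<xi> * x))"
  proof (rule integral_dominated_convergence[where w = "\<lambda>\<xi>. norm (fourier g \<xi>)"])
    show "AE \<xi> in lborel. (\<lambda>n. of_real (exp (- e n * \<xi>\<^sup>2)) * (fourier g \<xi> * iexp (\<xi> * x)))
        \<longlonglongrightarrow> fourier g \<xi> * iexp (\<xi> * x)"
    proof (rule AE_I2)
      fix \<xi>
      have "(\<lambda>n. of_real (exp (- e n * \<xi>\<^sup>2)) * (fourier g \<xi> * iexp (\<xi> * x)))
        \<longlonglongrightarrow> of_real (exp (- 0 * \<xi>\<^sup>2)) * (fourier g \<xi> * iexp (\<xi> * x))"
        by (intro tendsto_intros e_lim)
      then show "(\<lambda>n. of_real (exp (- e n * \<xi>\<^sup>2)) * (fourier g \<xi> * iexp (\<xi> * x)))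
        \<longlonglongrightarrow> fourier g \<xi> * iexp (\<xi> * x)" by simp
    qed
    show "AE \<xi> in lborel. norm (of_real (exp (- e n * \<xi>\<^sup>2)) * (fourier g \<xi> * iexp (\<xi> * x)))
        \<le> norm (fourier g \<xi>)" for n
      using e0[of n] by (intro AE_I2) (simp add: norm_mult mult_left_le_one_le)
  qed (use int in auto)
  have eq: "(LINT \<xi>|lborel. of_real (exp (- e n * \<xi>\<^sup>2)) * (fourier g \<xi> * iexp (\<xi> * x)))
      = sqrt (2 * pi) *\<^sub>R (LINT z|lborel. g (x + 1 / real (Suc n) * z) * of_real (exp (- (1/2) * z\<^sup>2)))" for n
  proof -
    define F where "F = (\<lambda>\<xi> y. of_real (exp (- e n * \<xi>\<^sup>2)) * g y * iexp (\<xi> * (x - y)))"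
    have [measurable]: "case_prod F \<in> borel_measurable (lborel \<Otimes>\<^sub>M lborel)"
      unfolding F_def by measurable
    have nF: "norm (F \<xi> y) = exp (- e n * \<xi>\<^sup>2) * norm (g y)" for \<xi> y
      by (simp add: F_def norm_mult)
    have "integrable (lborel \<Otimes>\<^sub>M lborel) (case_prod F)"
    proof (rule lborel_pair.Fubini_integrable)
      show "integrable lborel (\<lambda>\<xi>. LINT y|lborel. norm (case_prod F (\<xi>, y)))"
        using integrable_gaussian[OF e0[of n]] by (simp add: nF)
      show "AE \<xi> in lborel. integrable lborel (\<lambda>y. case_prod F (\<xi>, y))"
      proof (rule AE_I2)
        fix \<xi>
        have [measurable]: "F \<xi> \<in> borel_measurable lborel" unfolding F_def by measurable
        show "integrable lborel (\<lambda>y. case_prod F (\<xi>, y))"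
          by (rule Bochner_Integration.integrable_bound[where f = "\<lambda>y. exp (- e n * \<xi>\<^sup>2) * norm (g y)"])
            (use g in \<open>auto simp: nF intro!: integrable_mult_right integrable_norm\<close>)
      qed
    qed measurable
    from lborel_pair.Fubini_integral[OF this]
    have swap: "(LINT y|lborel. LINT \<xi>|lborel. F \<xi> y) = (LINT \<xi>|lborel. LINT y|lborel. F \<xi> y)"
      by simp
    have "(LINT \<xi>|lborel. of_real (exp (- e n * \<xi>\<^sup>2)) * (fourier g \<xi> * iexp (\<xi> * x)))
        = (LINT \<xi>|lborel. LINT y|lborel. F \<xi> y)"
    proof (intro Bochner_Integration.integral_cong refl)
      fix \<xi>
      have "(LINT y|lborel. F \<xi> y)
         = (LINT y|lborel. (of_real (exp (- e n * \<xi>\<^sup>2)) * iexp (\<xi> * x)) * (g y * exp (- \<i> * of_real (y * \<xi>))))"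
        unfolding F_def
        by (intro Bochner_Integration.integral_cong refl)
          (simp add: algebra_simps exp_diff exp_minus field_simps)
      also have "\<dots> = (of_real (exp (- e n * \<xi>\<^sup>2)) * iexp (\<xi> * x)) * fourier g \<xi>"
        unfolding fourier_def by (rule integral_mult_right_zero)
      finally show "of_real (exp (- e n * \<xi>\<^sup>2)) * (fourier g \<xi> * iexp (\<xi> * x)) = (LINT y|lborel. F \<xi> y)"
        by (simp add: mult_ac)
    qed
    also have "\<dots> = (LINT y|lborel. g y * of_real (sqrt (pi / e n) * exp (- (x - y)\<^sup>2 / (4 * e n))))"
      unfolding swap[symmetric]
    proof (intro Bochner_Integration.integral_cong refl)
      fix y
      have "(LINT \<xi>|lborel. F \<xi> y)
         = (LINT \<xi>|lborel. g y * (of_real (exp (- e n * \<xi>\<^sup>2)) * iexp ((x - y) * \<xi>)))"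
        unfolding F_def by (intro Bochner_Integration.integral_cong refl) (simp add: algebra_simps)
      then show "(LINT \<xi>|lborel. F \<xi> y) = g y * of_real (sqrt (pi / e n) * exp (- (x - y)\<^sup>2 / (4 * e n)))"
        using gaussian_fourier[OF e0[of n], of "x - y"] by simp
    qed
    \<comment> \<open>Substituting \<open>y = x + z / Suc n\<close> makes the Gaussian factor
      independent of \<open>n\<close> and moves the whole dependence on \<open>n\<close> into the
      argument of \<open>g\<close>.\<close>
    also have "\<dots> = \<bar>1 / real (Suc n)\<bar> *\<^sub>R (LINT z|lborel. g (x + 1 / real (Suc n) * z) *
        of_real (sqrt (pi / e n) * exp (- (x - (x + 1 / real (Suc n) * z))\<^sup>2 / (4 * e n))))"
      by (rule lborel_integral_real_affine) simp
    also have "(LINT z|lborel. g (x + 1 / real (Suc n) * z) *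
        of_real (sqrt (pi / e n) * exp (- (x - (x + 1 / real (Suc n) * z))\<^sup>2 / (4 * e n))))
       = (LINT z|lborel. sqrt (pi / e n) *\<^sub>R (g (x + 1 / real (Suc n) * z) * of_real (exp (- (1/2) * z\<^sup>2))))"
      by (intro Bochner_Integration.integral_cong refl)
        (simp add: e_def power_divide scaleR_conv_of_real del: of_nat_Suc)
    also have "\<dots> = sqrt (pi / e n) *\<^sub>R (LINT z|lborel. (g (x + 1 / real (Suc n) * z) * of_real (exp (- (1/2) * z\<^sup>2))))"
      by (rule integral_scaleR_right)
    also have "sqrt (pi / e n) = real (Suc n) * sqrt (2 * pi)"
    proof -
      have "pi / e n = (real (Suc n))\<^sup>2 * (2 * pi)" by (simp add: e_def del: of_nat_Suc)
      then show ?thesis by (simp only: real_sqrt_mult real_sqrt_abs abs_of_nat)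
    qed
    finally show ?thesis unfolding scaleR_scaleR by (simp only: divide_inverse) simp
  qed
  \<comment> \<open>Continuity of \<open>g\<close> at \<open>x\<close> gives the pointwise limit,
    and its boundedness gives the majorant.\<close>
  have "(\<lambda>n. LINT z|lborel. g (x + 1 / real (Suc n) * z) * of_real (exp (- (1/2) * z\<^sup>2)))
      \<longlonglongrightarrow> (LINT z|lborel. g x * of_real (exp (- (1/2) * z\<^sup>2)))"
  proof (rule integral_dominated_convergence[where w = "\<lambda>z. B * exp (- (1/2) * z\<^sup>2)"])
    show "integrable lborel (\<lambda>z. B * exp (- (1/2) * z\<^sup>2))"
      using integrable_gaussian[of "1/2"] by simp
    show "AE z in lborel. (\<lambda>n. g (x + 1 / real (Suc n) * z) * of_real (exp (- (1/2) * z\<^sup>2)))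
        \<longlonglongrightarrow> g x * of_real (exp (- (1/2) * z\<^sup>2))"
    proof (rule AE_I2)
      fix z
      have "(\<lambda>n. x + inverse (real (Suc n)) * z) \<longlonglongrightarrow> x + 0 * z"
        by (intro tendsto_intros LIMSEQ_inverse_real_of_nat)
      then have "(\<lambda>n. x + 1 / real (Suc n) * z) \<longlonglongrightarrow> x" by (simp add: field_simps)
      moreover have "isCont g x" using cont by (simp add: continuous_on_eq_continuous_at)
      ultimately have "(\<lambda>n. g (x + 1 / real (Suc n) * z)) \<longlonglongrightarrow> g x"
        by (rule isCont_tendsto_compose[rotated])
      then show "(\<lambda>n. g (x + 1 / real (Suc n) * z) * of_real (exp (- (1/2) * z\<^sup>2)))
        \<longlonglongrightarrow> g x * of_real (exp (- (1/2) * z\<^sup>2))" by (intro tendsto_intros)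
    qed
    show "AE z in lborel. norm (g (x + 1 / real (Suc n) * z) * of_real (exp (- (1/2) * z\<^sup>2)))
        \<le> B * exp (- (1/2) * z\<^sup>2)" for n
      using bdd by (intro AE_I2) (simp add: norm_mult)
  qed auto
  moreover have "(LINT z|lborel. g x * of_real (exp (- (1/2) * z\<^sup>2))) = g x * of_real (sqrt (2 * pi))"
    using gaussian_fourier[of "1/2" 0] by simp
  ultimately have "(\<lambda>n. sqrt (2 * pi) *\<^sub>R (LINT z|lborel. g (x + 1 / real (Suc n) * z) * of_real (exp (- (1/2) * z\<^sup>2))))
      \<longlonglongrightarrow> sqrt (2 * pi) *\<^sub>R (g x * of_real (sqrt (2 * pi)))"
    by (intro tendsto_intros) auto
  then have "(LINT \<xi>|lborel. fourier g \<xi> * iexp (\<xi> * x)) = sqrt (2 * pi) *\<^sub>R (g x * of_real (sqrt (2 * pi)))"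
    using lhs unfolding eq by (rule LIMSEQ_unique[rotated])
  also have "\<dots> = of_real (sqrt (2 * pi) * sqrt (2 * pi)) * g x"
    unfolding of_real_mult scaleR_conv_of_real by (simp only: mult_ac)
  also have "sqrt (2 * pi) * sqrt (2 * pi) = 2 * pi" by simp
  finally show ?thesis by simp
qed

section \<open>Inverse Fourier integrals and functions with many zeros\<close>

text \<open>Difference quotients can be evaluated along sequences, which is what dominated
  convergence requires.\<close>

lemma has_vector_derivative_iff_tendsto:
  "(f has_vector_derivative D) (at x) \<longleftrightarrow> ((\<lambda>y. (f y - f x) /\<^sub>R (y - x)) \<longlongrightarrow> D) (at x)"
proof -
  have "norm (f y - f x - (y - x) *\<^sub>R D) / norm (y - x) = norm ((f y - f x) /\<^sub>R (y - x) - D)"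
    if "y \<noteq> x" for y
  proof -
    have "(f y - f x) /\<^sub>R (y - x) - D = (f y - f x - (y - x) *\<^sub>R D) /\<^sub>R (y - x)"
      using that by (simp add: scaleR_diff_right)
    then show ?thesis by (simp add: divide_inverse)
  qed
  then have "((\<lambda>y. norm (f y - f x - (y - x) *\<^sub>R D) / norm (y - x)) \<longlongrightarrow> 0) (at x)
      \<longleftrightarrow> ((\<lambda>y. norm ((f y - f x) /\<^sub>R (y - x) - D)) \<longlongrightarrow> 0) (at x)"
    by (intro filterlim_cong refl) (auto simp: eventually_at_filter)
  then show ?thesis
    unfolding has_vector_derivative_def has_derivative_iff_norm
    by (simp add: bounded_linear_scaleR_left tendsto_norm_zero_iff LIM_zero_iff)
qed

lemma norm_minus_one_iexp_le: "norm (iexp x - 1) \<le> \<bar>x\<bar>"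
  using iexp_approx1[of x 0] by simp

text \<open>Differentiation under the integral sign: as
  \<open>\<bar>exp (\<i> s) - 1\<bar> \<le> \<bar>s\<bar>\<close>, all difference quotients of the
  integrand are dominated by \<open>norm (\<xi> * u \<xi>)\<close>.\<close>

lemma has_vector_derivative_inverse_fourier:
  fixes u :: "real \<Rightarrow> complex"
  assumes u: "integrable lborel u" and u1: "integrable lborel (\<lambda>\<xi>. of_real \<xi> * u \<xi>)"
  shows "((\<lambda>x. LINT \<xi>|lborel. u \<xi> * iexp (\<xi> * x)) has_vector_derivative
     (LINT \<xi>|lborel. (\<i> * of_real \<xi> * u \<xi>) * iexp (\<xi> * x))) (at x)"
proof -
  have [measurable]: "u \<in> borel_measurable borel" using u by (auto dest: borel_measurable_integrable)
  let ?F = "\<lambda>x. LINT \<xi>|lborel. u \<xi> * iexp (\<xi> * x)"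
  have int: "integrable lborel (\<lambda>\<xi>. u \<xi> * iexp (\<xi> * x))" for x
    by (rule Bochner_Integration.integrable_bound[OF u]) (auto simp: norm_mult)
  have "((\<lambda>y. (?F y - ?F x) /\<^sub>R (y - x)) \<longlongrightarrow> (LINT \<xi>|lborel. (\<i> * of_real \<xi> * u \<xi>) * iexp (\<xi> * x))) (at x)"
    unfolding tendsto_at_iff_sequentially comp_def
  proof (intro allI impI)
    fix X assume X: "\<forall>i. X i \<in> UNIV - {x}" "X \<longlonglongrightarrow> x"
    have eq: "(?F (X n) - ?F x) /\<^sub>R (X n - x)
       = (LINT \<xi>|lborel. (u \<xi> * iexp (\<xi> * X n) - u \<xi> * iexp (\<xi> * x)) /\<^sub>R (X n - x))" for n
      using int by (subst integral_scaleR_right, subst Bochner_Integration.integral_diff) auto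
    have "(\<lambda>n. LINT \<xi>|lborel. (u \<xi> * iexp (\<xi> * X n) - u \<xi> * iexp (\<xi> * x)) /\<^sub>R (X n - x))
      \<longlonglongrightarrow> (LINT \<xi>|lborel. (\<i> * of_real \<xi> * u \<xi>) * iexp (\<xi> * x))"
    proof (rule integral_dominated_convergence[where w = "\<lambda>\<xi>. norm (of_real \<xi> * u \<xi>)"])
      show "AE \<xi> in lborel. (\<lambda>n. (u \<xi> * iexp (\<xi> * X n) - u \<xi> * iexp (\<xi> * x)) /\<^sub>R (X n - x))
         \<longlonglongrightarrow> (\<i> * of_real \<xi> * u \<xi>) * iexp (\<xi> * x)"
      proof (rule AE_I2)
        fix \<xi>
        have "((\<lambda>y. iexp (\<xi> * y)) has_vector_derivative \<i> * of_real \<xi> * iexp (\<xi> * x)) (at x)"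
          by (auto intro!: derivative_eq_intros simp: Re_exp Im_exp has_vector_derivative_complex_iff)
        then have "((\<lambda>y. u \<xi> * iexp (\<xi> * y)) has_vector_derivative u \<xi> * (\<i> * of_real \<xi> * iexp (\<xi> * x))) (at x)"
          by (rule has_vector_derivative_mult_right)
        then have "((\<lambda>y. (u \<xi> * iexp (\<xi> * y) - u \<xi> * iexp (\<xi> * x)) /\<^sub>R (y - x))
            \<longlongrightarrow> u \<xi> * (\<i> * of_real \<xi> * iexp (\<xi> * x))) (at x)"
          by (simp add: has_vector_derivative_iff_tendsto)
        then show "(\<lambda>n. (u \<xi> * iexp (\<xi> * X n) - u \<xi> * iexp (\<xi> * x)) /\<^sub>R (X n - x))
         \<longlonglongrightarrow> (\<i> * of_real \<xi> * u \<xi>) * iexp (\<xi> * x)"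
          unfolding tendsto_at_iff_sequentially comp_def using X by (simp add: algebra_simps)
      qed
      show "AE \<xi> in lborel. norm ((u \<xi> * iexp (\<xi> * X n) - u \<xi> * iexp (\<xi> * x)) /\<^sub>R (X n - x))
          \<le> norm (of_real \<xi> * u \<xi>)" for n
      proof (rule AE_I2)
        fix \<xi>
        have "u \<xi> * iexp (\<xi> * X n) - u \<xi> * iexp (\<xi> * x) = u \<xi> * iexp (\<xi> * x) * (iexp (\<xi> * (X n - x)) - 1)"
          by (simp add: algebra_simps exp_diff exp_add)
        then have "norm (u \<xi> * iexp (\<xi> * X n) - u \<xi> * iexp (\<xi> * x)) \<le> norm (u \<xi>) * \<bar>\<xi> * (X n - x)\<bar>"
          using norm_minus_one_iexp_le[of "\<xi> * (X n - x)"]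
          by (simp only: norm_mult norm_iexp_mult mult_1_right mult_left_mono norm_ge_zero) 
        moreover have "\<bar>X n - x\<bar> > 0" using X by auto
        ultimately show "norm ((u \<xi> * iexp (\<xi> * X n) - u \<xi> * iexp (\<xi> * x)) /\<^sub>R (X n - x))
          \<le> norm (of_real \<xi> * u \<xi>)"
          by (simp only: norm_scaleR norm_mult norm_of_real abs_mult abs_inverse) (simp add: field_simps)
      qed
    qed (use u1 in auto)
    then show "(\<lambda>n. (?F (X n) - ?F x) /\<^sub>R (X n - x)) \<longlonglongrightarrow> (LINT \<xi>|lborel. (\<i> * of_real \<xi> * u \<xi>) * iexp (\<xi> * x))"
      unfolding eq .
  qed
  then show ?thesis by (simp add: has_vector_derivative_iff_tendsto)
qed

section \<open>Interpolation error at many zeros\<close>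

text \<open>\<open>H\<close> lists successive derivatives. Rolle's theorem between consecutive zeros
  gives \<open>H 1\<close> one zero fewer, again in increasing order, so induction on
  \<open>m\<close> applies to the shifted list.\<close>

lemma Rolle_iterated:
  fixes H :: "nat \<Rightarrow> real \<Rightarrow> real" and z :: "nat \<Rightarrow> real"
  assumes "\<And>i x. i < m \<Longrightarrow> (H i has_real_derivative H (Suc i) x) (at x)"
    and "\<And>i. i < m \<Longrightarrow> z i < z (Suc i)"
    and "\<And>i. i \<le> m \<Longrightarrow> H 0 (z i) = 0"
  shows "\<exists>c. H m c = 0"
  using assms
proof (induction m arbitrary: H z)
  case 0
  then show ?case by auto
next
  case (Suc m)
  have "\<exists>c. z i < c \<and> c < z (Suc i) \<and> H 1 c = 0" if "i \<le> m" for i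
  proof -
    have der: "(H 0 has_real_derivative H 1 x) (at x)" for x using Suc.prems(1)[of 0] by simp
    have "\<exists>c>z i. c < z (Suc i) \<and> (\<lambda>h. H 1 c * h) = (\<lambda>v. 0)"
    proof (rule Rolle_deriv)
      show "z i < z (Suc i)" using Suc.prems(2)[of i] that by simp
      show "H 0 (z i) = H 0 (z (Suc i))" using Suc.prems(3)[of i] Suc.prems(3)[of "Suc i"] that by simp
      show "continuous_on {z i..z (Suc i)} (H 0)"
        using der by (meson DERIV_continuous continuous_at_imp_continuous_on)
      show "(H 0 has_derivative (\<lambda>h. H 1 x * h)) (at x)" for x
        using der[of x] by (simp add: has_field_derivative_def)
    qed
    then show ?thesis by (metis mult.right_neutral)
  qed
  then obtain c where c: "\<And>i. i \<le> m \<Longrightarrow> z i < c i \<and> c i < z (Suc i) \<and> H 1 (c i) = 0" by metis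
  have "\<exists>d. H (Suc m) d = 0"
  proof (rule Suc.IH[of "\<lambda>i. H (Suc i)" c])
    show "c i < c (Suc i)" if "i < m" for i using c[of i] c[of "Suc i"] that by simp
  qed (use Suc.prems(1) c in auto)
  then show ?case .
qed

text \<open>The product is monic of degree \<open>m\<close>, and only its leading term survives
  \<open>m\<close> differentiations.\<close>

lemma higher_pderiv_prod_linear:
  fixes z :: "nat \<Rightarrow> real"
  shows "(pderiv ^^ m) (\<Prod>i<m. [:- z i, 1:]) = [:fact m:]"
proof (rule poly_eqI)
  fix n
  let ?p = "\<Prod>i<m. [:- z i, 1:]"
  have deg: "degree ?p = m" by (subst degree_prod_eq_sum_degree) auto
  have "lead_coeff ?p = 1" by (simp add: lead_coeff_prod)
  then show "coeff ((pderiv ^^ m) ?p) n = coeff [:fact m:] n"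
    using deg by (cases n) (auto simp: coeff_higher_pderiv coeff_eq_0 pochhammer_fact)
qed

text \<open>Subtract from \<open>H 0\<close> the multiple of \<open>\<Prod>i. x - z i\<close> that makes it vanish at \<open>y\<close> as well, and apply
  Rolle's theorem \<open>m\<close> times.\<close>

lemma norm_le_of_zeros:
  fixes H :: "nat \<Rightarrow> real \<Rightarrow> real" and z :: "nat \<Rightarrow> real"
  assumes der: "\<And>i x. i < m \<Longrightarrow> (H i has_real_derivative H (Suc i) x) (at x)"
    and z: "\<And>i. Suc i < m \<Longrightarrow> z i < z (Suc i)"
    and 0: "\<And>i. i < m \<Longrightarrow> H 0 (z i) = 0"
    and y: "\<And>i. i < m \<Longrightarrow> y < z i" and h: "\<And>i. i < m \<Longrightarrow> z i - y \<le> h"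
    and B: "\<And>x. \<bar>H m x\<bar> \<le> B"
  shows "\<bar>H 0 y\<bar> \<le> h ^ m / fact m * B"
proof -
  define p where "p = (\<Prod>i<m. [:- z i, 1:])"
  have p: "poly p x = (\<Prod>i<m. x - z i)" for x by (simp add: p_def poly_prod)
  have py: "poly p y \<noteq> 0" using y by (fastforce simp: p)
  define q where "q = smult (H 0 y / poly p y) p"
  \<comment> \<open>As \<open>y\<close> lies to the left of every \<open>z i\<close>, putting it in
    front keeps the order and yields the \<open>m + 1\<close> zeros that Rolle's theorem
    needs.\<close>
  define w where "w i = (case i of 0 \<Rightarrow> y | Suc j \<Rightarrow> z j)" for i
  have "\<exists>c. (\<lambda>i x. H i x - poly ((pderiv ^^ i) q) x) m c = 0"
  proof (rule Rolle_iterated[where z = w])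
    show "((\<lambda>x. H i x - poly ((pderiv ^^ i) q) x) has_real_derivative
        H (Suc i) x - poly ((pderiv ^^ Suc i) q) x) (at x)" if "i < m" for i x
      using der[OF that] by (auto intro!: derivative_eq_intros poly_DERIV)
    show "w i < w (Suc i)" if "i < m" for i using that y z by (cases i) (auto simp: w_def)
    show "H 0 (w i) - poly ((pderiv ^^ 0) q) (w i) = 0" if "i \<le> m" for i
    proof (cases i)
      case 0 then show ?thesis using py by (simp add: w_def q_def)
    next
      case (Suc j)
      then have "poly p (z j) = 0" using that by (auto simp: p)
      then show ?thesis using Suc 0[of j] that by (simp add: w_def q_def)
    qed
  qed
  then obtain c where "H m c = poly ((pderiv ^^ m) q) c" by auto
  also have "\<dots> = H 0 y / poly p y * fact m"
    by (simp add: q_def higher_pderiv_smult p_def higher_pderiv_prod_linear)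
  finally have "H 0 y = H m c * poly p y / fact m" using py by simp
  then have "\<bar>H 0 y\<bar> = \<bar>H m c\<bar> * \<bar>poly p y\<bar> / fact m" by (simp add: abs_mult)
  also have "\<bar>poly p y\<bar> \<le> h ^ m"
  proof -
    have "\<bar>poly p y\<bar> = (\<Prod>i<m. \<bar>y - z i\<bar>)" by (simp add: p abs_prod)
    also have "\<dots> \<le> (\<Prod>i<m. h)" using y h by (intro prod_mono) (force simp: abs_if)
    finally show ?thesis by simp
  qed
  finally have "\<bar>H 0 y\<bar> \<le> \<bar>H m c\<bar> * h ^ m / fact m"
    by (simp add: divide_right_mono mult_left_mono)
  \<comment> \<open>A zero to the right of \<open>y\<close> forces \<open>h \<ge> 0\<close>. If
    \<open>m = 0\<close> there is none and \<open>h\<close> may be negative, but then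
    \<open>h ^ m = 1\<close>.\<close>
  also have "\<dots> \<le> B * h ^ m / fact m"
  proof (cases "m = 0")
    case False
    then have "h \<ge> 0" using y[of 0] h[of 0] by simp
    then show ?thesis using B[of c] by (intro divide_right_mono mult_right_mono) auto
  qed (use B in auto)
  finally show ?thesis by (simp add: mult_ac)
qed

text \<open>A crude Stirling bound: \<open>m ^ m / fact m\<close> is a single term of the
  exponential series at \<open>m\<close>.\<close>

lemma power_le_exp_fact: "real m ^ m \<le> exp (real m) * fact m"
proof -
  have "(\<lambda>n. real m ^ n / fact n) sums exp (real m)"
    using exp_converges[of "real m"] by (simp add: field_simps)
  then have "sum (\<lambda>n. real m ^ n / fact n) {m} \<le> exp (real m)"
    using sum_le_suminf[of "\<lambda>n. real m ^ n / fact n" "{m}"] by (simp add: sums_iff)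
  then show ?thesis by (simp add: field_simps)
qed

section \<open>Series of modulated Gaussians\<close>

lemma iter_deriv_eqI:
  assumes "\<And>i x. (F i has_vector_derivative F (Suc i) x) (at x)"
  shows "iter_deriv j (F 0) = F j"
proof (induction j)
  case (Suc j)
  have "iter_deriv (Suc j) (F 0) = (\<lambda>x. vector_derivative (iter_deriv j (F 0)) (at x))"
    by (simp add: iter_deriv_def)
  then show ?case using vector_derivative_at[OF assms[of j]] by (auto simp: Suc.IH)
qed (simp add: iter_deriv_def)

lemma C_infinityI:
  assumes "\<And>i x. (F i has_vector_derivative F (Suc i) x) (at x)"
  shows "C_infinity (F 0)"
  using assms by (auto simp: C_infinity_def iter_deriv_eqI[of F] intro: differentiableI_vector)

text \<open>By the Weierstrass test the differentiated series converges uniformly on the whole line,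
  so termwise differentiation is legitimate.\<close>

lemma has_vector_derivative_suminf:
  fixes f f' :: "nat \<Rightarrow> real \<Rightarrow> 'a::banach"
  assumes der: "\<And>n x. (f n has_vector_derivative f' n x) (at x)"
    and f: "\<And>n x. norm (f n x) \<le> A n" "summable A"
    and f': "\<And>n x. norm (f' n x) \<le> B n" "summable B"
  shows "((\<lambda>x. \<Sum>n. f n x) has_vector_derivative (\<Sum>n. f' n x)) (at x)"
proof -
  have sf: "summable (\<lambda>n. f n x)" for x by (rule summable_comparison_test'[OF f(2), of 0]) (use f(1) in auto)
  have lim: "uniform_limit UNIV (\<lambda>n x. \<Sum>i<n. f' i x) (\<lambda>x. \<Sum>i. f' i x) sequentially"
    using f' by (intro Weierstrass_m_test) auto
  have "\<exists>g. \<forall>x\<in>UNIV. (\<lambda>n. f n x) sums g x \<and>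
      (g has_derivative (\<lambda>h. h *\<^sub>R (\<Sum>i. f' i x))) (at x within UNIV)"
  proof (rule has_derivative_series[where f' = "\<lambda>n x h. h *\<^sub>R f' n x"])
    show "(f n has_derivative (\<lambda>h. h *\<^sub>R f' n x)) (at x within UNIV)" for n x
      using der by (simp add: has_vector_derivative_def)
    fix e :: real assume "e > 0"
    from uniform_limitD[OF lim this]
    show "\<forall>\<^sub>F n in sequentially. \<forall>x\<in>UNIV. \<forall>h. norm ((\<Sum>i<n. h *\<^sub>R f' i x) - h *\<^sub>R (\<Sum>i. f' i x)) \<le> e * norm h"
    proof eventually_elim
      case (elim n)
      have "norm ((\<Sum>i<n. h *\<^sub>R f' i x) - h *\<^sub>R (\<Sum>i. f' i x)) \<le> e * norm h" for x h
      proof -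
        have "norm ((\<Sum>i<n. h *\<^sub>R f' i x) - h *\<^sub>R (\<Sum>i. f' i x)) = \<bar>h\<bar> * dist (\<Sum>i<n. f' i x) (\<Sum>i. f' i x)"
          by (simp add: dist_norm flip: scaleR_sum_right scaleR_diff_right)
        also have "\<dots> \<le> \<bar>h\<bar> * e" using elim[rule_format, of x] by (intro mult_left_mono) auto
        finally show ?thesis by (simp add: mult.commute)
      qed
      then show ?case by blast
    qed
  qed (use sf[of 0] in \<open>auto dest: summable_sums\<close>)
  then obtain g where g: "\<And>x. (\<lambda>n. f n x) sums g x"
    "\<And>x. (g has_vector_derivative (\<Sum>i. f' i x)) (at x)"
    by (auto simp: has_vector_derivative_def)
  then have "g = (\<lambda>x. \<Sum>n. f n x)" by (auto simp: sums_iff)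
  with g show ?thesis by simp
qed

text \<open>The Cauchy estimate on a circle of radius \<open>1 / (1 + a + \<bar>b\<bar>)\<close>, on which the modulated
  Gaussian is bounded by its values on the real line.\<close>

lemma norm_higher_deriv_gaussian_le:
  fixes a s b x :: real
  assumes "a \<ge> 0"
  shows "norm ((deriv ^^ j) (\<lambda>z. exp (- of_real a * (z - of_real s)\<^sup>2 + \<i> * of_real b * z)) (complex_of_real x))
     \<le> fact j * (1 + a + \<bar>b\<bar>) ^ j * exp (3 - a * (x - s)\<^sup>2 / 2)"
proof -
  define E where "E = (\<lambda>z. exp (- complex_of_real a * (z - of_real s)\<^sup>2 + \<i> * of_real b * z))"
  define r where "r = 1 / (1 + a + \<bar>b\<bar>)"
  have r: "0 < r" "r \<le> 1" using assms by (auto simp: r_def)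
  have ar: "a * r \<le> 1" and br: "\<bar>b\<bar> * r \<le> 1" using assms by (auto simp: r_def field_simps)
  have "norm ((deriv ^^ j) E (of_real x)) \<le> fact j * exp (3 - a * (x - s)\<^sup>2 / 2) / r ^ j"
  proof (rule Cauchy_inequality)
    show "E holomorphic_on ball (of_real x) r" unfolding E_def by (intro holomorphic_intros)
    show "continuous_on (cball (of_real x) r) E" unfolding E_def by (intro continuous_intros)
    fix z :: complex assume z: "norm (of_real x - z) = r"
    define u where "u = Re z - x"
    define w where "w = Im z"
    have "r\<^sup>2 = u\<^sup>2 + w\<^sup>2"
      unfolding z[symmetric] cmod_power2 by (simp add: u_def w_def power2_eq_square algebra_simps)
    then have "u\<^sup>2 + w\<^sup>2 \<le> r" using r mult_left_le[of r r] by (simp add: power2_eq_square)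
    have "Re (- complex_of_real a * (z - of_real s)\<^sup>2 + \<i> * of_real b * z)
        = - a * ((x - s + u)\<^sup>2 - w\<^sup>2) - b * w"
      by (simp add: u_def w_def power2_eq_square algebra_simps)
    also have "- a * ((x - s + u)\<^sup>2 - w\<^sup>2) \<le> - a * ((x - s)\<^sup>2 / 2 - u\<^sup>2 - w\<^sup>2)"
    proof -
      \<comment> \<open>This is \<open>(d + 2 * u)\<^sup>2 \<ge> 0\<close>. Displacing the point by
        \<open>u\<close> costs half of the Gaussian decay and a term \<open>a * u\<^sup>2\<close>,
        which the choice of \<open>r\<close> keeps bounded.\<close>
      have "d\<^sup>2 / 2 - u\<^sup>2 - w\<^sup>2 \<le> (d + u)\<^sup>2 - w\<^sup>2" for d
        using zero_le_power2[of "d + 2 * u"] by (simp add: power2_eq_square algebra_simps)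
      then have "(x - s)\<^sup>2 / 2 - u\<^sup>2 - w\<^sup>2 \<le> (x - s + u)\<^sup>2 - w\<^sup>2" .
      then show ?thesis using assms by (simp add: mult_left_mono)
    qed
    also have "\<dots> = a * (u\<^sup>2 + w\<^sup>2) - a * (x - s)\<^sup>2 / 2" by (simp add: algebra_simps)
    also have "a * (u\<^sup>2 + w\<^sup>2) \<le> 1"
      using mult_left_mono[OF \<open>u\<^sup>2 + w\<^sup>2 \<le> r\<close> assms] ar by simp
    finally have "Re (- complex_of_real a * (z - of_real s)\<^sup>2 + \<i> * of_real b * z) \<le> 1 - a * (x - s)\<^sup>2 / 2 - b * w"
      by simp
    moreover have "- b * w \<le> 1"
    proof -
      have "\<bar>w\<bar> \<le> r" using abs_Im_le_cmod[of "of_real x - z"] z by (simp add: w_def)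
      then have "\<bar>b\<bar> * \<bar>w\<bar> \<le> \<bar>b\<bar> * r" by (intro mult_left_mono) auto
      then show ?thesis using br abs_ge_minus_self[of "b * w"] by (simp add: abs_mult)
    qed
    ultimately show "norm (E z) \<le> exp (3 - a * (x - s)\<^sup>2 / 2)" by (simp add: E_def)
  qed (use r in auto)
  then show ?thesis by (simp add: E_def r_def field_simps power_divide)
qed

text \<open>Once \<open>n \<ge> D\<close>, the exponent is at most \<open>D - n\<close> because
  \<open>M n \<ge> 1\<close>; from there on a geometric series is a majorant.\<close>

lemma summable_exp_linear:
  fixes M :: "nat \<Rightarrow> real" and D :: real
  assumes "\<And>n. M n \<ge> 1"
  shows "summable (\<lambda>n. exp (M n * (D - n)))"
proof (rule summable_comparison_test_ev)
  show "summable (\<lambda>n. exp D * exp (- 1) ^ n)" by (intro summable_mult summable_geometric) simp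
  show "\<forall>\<^sub>F n in sequentially. norm (exp (M n * (D - n))) \<le> exp D * exp (- 1) ^ n"
  proof (rule eventually_mono[OF eventually_ge_at_top])
    fix n assume "n \<ge> nat \<lceil>D\<rceil>"
    then have "D - n \<le> 0" by linarith
    then have "M n * (D - n) \<le> 1 * (D - n)" using assms by (intro mult_right_mono_neg) auto
    then show "norm (exp (M n * (D - n))) \<le> exp D * exp (- 1) ^ n"
      by (simp flip: exp_of_nat_mult exp_add)
  qed
qed

text \<open>In units of \<open>M n\<close>, the weighted \<open>j\<close>-th derivative of the
  \<open>n\<close>-th summand has exponent at most \<open>1 - n\<close> from the coefficient,
  \<open>j\<close> from the Cauchy estimate and \<open>B\<close> from the weight against the
  Gaussian. The sum over \<open>n\<close> converges for any fixed \<open>j\<close> and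
  \<open>B\<close>. Centre and frequency are both free, so that the result covers \<open>f\<close>
  and its Fourier transform.\<close>

lemma gaussian_series:
  fixes C a s b M :: "nat \<Rightarrow> real" and v :: "real \<Rightarrow> real"
  assumes C: "\<And>n. \<bar>C n\<bar> \<le> exp (M n - n * M n)" and a: "\<And>n. a n \<ge> 0"
    and ab: "\<And>n. 1 + a n + \<bar>b n\<bar> \<le> exp (M n)" and M: "\<And>n. M n \<ge> 1"
    and v0: "\<And>x. v x \<ge> 0"
    and v: "\<And>l. l > 0 \<Longrightarrow> \<exists>B. \<forall>n x. l * v x - a n * (x - s n)\<^sup>2 / 2 \<le> B * M n"
  defines "F \<equiv> \<lambda>x. \<Sum>n. C n * exp (- of_real (a n) * (of_real x - of_real (s n))\<^sup>2 + \<i> * of_real (b n) * of_real x)"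
  shows "C_infinity F"
    and "l > 0 \<Longrightarrow> \<exists>K. \<forall>x. norm (iter_deriv j F x) * exp (l * v x) \<le> K"
proof -
  define E where "E n = (\<lambda>z. exp (- complex_of_real (a n) * (z - of_real (s n))\<^sup>2 + \<i> * of_real (b n) * z))" for n
  define T where "T n j x = C n * (deriv ^^ j) (E n) (complex_of_real x)" for n j x
  define W where "W D j n = fact j * exp 3 * exp (M n * (D - n))" for D :: real and j n :: nat
  have W: "summable (W D j)" for D j
    unfolding W_def using M by (intro summable_mult summable_exp_linear)
  have T_le: "\<exists>D. \<forall>n x. norm (T n j x) * exp (l * v x) \<le> W D j n" if l: "l > 0" for l j
  proof -
    from v[OF l] obtain B where B: "\<And>n x. l * v x - a n * (x - s n)\<^sup>2 / 2 \<le> B * M n" by blast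
    have "norm (T n j x) * exp (l * v x) \<le> W (1 + real j + B) j n" for n x
    proof -
      have "norm (T n j x) \<le> exp (M n - n * M n) * (fact j * (1 + a n + \<bar>b n\<bar>) ^ j * exp (3 - a n * (x - s n)\<^sup>2 / 2))"
        unfolding T_def E_def norm_mult norm_of_real
        using C a by (intro mult_mono norm_higher_deriv_gaussian_le) auto
      also have "\<dots> \<le> exp (M n - n * M n) * (fact j * exp (M n) ^ j * exp (3 - a n * (x - s n)\<^sup>2 / 2))"
        using ab[of n] a[of n] by (intro mult_left_mono mult_right_mono power_mono) auto
      finally have "norm (T n j x) * exp (l * v x)
        \<le> exp (M n - n * M n) * (fact j * exp (M n) ^ j * exp (3 - a n * (x - s n)\<^sup>2 / 2)) * exp (l * v x)"
        by (intro mult_right_mono) auto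
      also have "\<dots> = fact j * exp 3 * exp (M n * (1 + real j - real n) + (l * v x - a n * (x - s n)\<^sup>2 / 2))"
        by (simp add: algebra_simps flip: exp_of_nat_mult exp_add)
      also have "\<dots> \<le> fact j * exp 3 * exp (M n * (1 + real j - real n) + B * M n)"
        using B[of x n] by simp
      also have "\<dots> = W (1 + real j + B) j n" by (simp add: W_def algebra_simps)
      finally show ?thesis .
    qed
    then show ?thesis by blast
  qed
  \<comment> \<open>The unweighted majorants for termwise differentiation come from
    \<open>l = 1\<close>, since the weight factor is at least 1.\<close>
  have "\<exists>D. \<forall>n x. norm (T n j x) \<le> W D j n" for j
  proof -
    obtain D where D: "\<And>n x. norm (T n j x) * exp (1 * v x) \<le> W D j n" using T_le[of 1 j] by auto
    have "norm (T n j x) \<le> W D j n" for n x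
      using D[of n x] v0[of x] mult_left_mono[of 1 "exp (v x)" "norm (T n j x)"] by simp
    then show ?thesis by blast
  qed
  then obtain D where D: "\<And>n j x. norm (T n j x) \<le> W (D j) j n" by metis
  have dT: "(T n j has_vector_derivative T n (Suc j) x) (at x)" for n j x
  proof -
    have "E n holomorphic_on UNIV" unfolding E_def by (intro holomorphic_intros)
    then have "(deriv ^^ j) (E n) holomorphic_on UNIV" by (intro holomorphic_higher_deriv) auto
    then have "((deriv ^^ j) (E n) has_field_derivative (deriv ^^ Suc j) (E n) (of_real x)) (at (of_real x))"
      by (simp add: holomorphic_derivI)
    then have "((\<lambda>x. (deriv ^^ j) (E n) (of_real x)) has_vector_derivative (deriv ^^ Suc j) (E n) (of_real x)) (at x)"
      by (rule has_vector_derivative_real_field)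
    then show ?thesis unfolding T_def by (rule has_vector_derivative_mult_right)
  qed
  define G where "G j x = (\<Sum>n. T n j x)" for j x
  have G: "(G j has_vector_derivative G (Suc j) x) (at x)" for j x
    unfolding G_def using D W by (intro has_vector_derivative_suminf[OF dT]) auto
  have F: "F = G 0" by (simp add: F_def G_def T_def E_def fun_eq_iff)
  show "C_infinity F" unfolding F by (rule C_infinityI[of G, OF G])
  show "\<exists>K. \<forall>x. norm (iter_deriv j F x) * exp (l * v x) \<le> K" if l: "l > 0" for l j
  proof -
    obtain D where D: "\<And>n x. norm (T n j x) * exp (l * v x) \<le> W D j n" using T_le[OF l] by blast
    have "norm (iter_deriv j F x) * exp (l * v x) \<le> suminf (W D j)" for x
    proof -
      have s: "summable (\<lambda>n. exp (l * v x) *\<^sub>R T n j x)"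
        by (rule summable_comparison_test'[OF W[of D j], of 0]) (use D in \<open>simp add: mult.commute\<close>)
      have "summable (\<lambda>n. T n j x)" using summable_scaleR_right[OF s, of "exp (- (l * v x))"]
        by (simp flip: exp_add)
      then have "exp (l * v x) *\<^sub>R G j x = (\<Sum>n. exp (l * v x) *\<^sub>R T n j x)"
        unfolding G_def by (rule suminf_scaleR_right)
      then have "norm (exp (l * v x) *\<^sub>R G j x) \<le> suminf (W D j)"
        using D by (simp only:) (intro norm_suminf_le W, simp add: mult.commute)
      then show ?thesis unfolding F iter_deriv_eqI[of G, OF G] by (simp add: mult.commute)
    qed
    then show ?thesis by blast
  qed
qed

section \<open>Weights\<close>

context
  fixes \<omega> :: "real \<Rightarrow> real"
  assumes w: "weight \<omega>"
begin

lemma weight_mono: "0 \<le> s \<Longrightarrow> s \<le> t \<Longrightarrow> \<omega> s \<le> \<omega> t"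
  using w by (auto simp: weight_def mono_on_def)

lemma weight_nonneg: "0 \<le> t \<Longrightarrow> 0 \<le> \<omega> t"
  using w by (auto simp: weight_def)

lemma weight_ge_ln: "\<forall>\<^sub>F t in at_top. ln (1 + t\<^sup>2) \<le> \<omega> t"
proof -
  have "(\<lambda>t. ln (1 + t\<^sup>2)) \<in> o[at_top](\<omega>)" using w by (simp add: weight_def)
  from landau_o.smallD[OF this zero_less_one]
  show ?thesis using eventually_ge_at_top[of 0]
    by eventually_elim (use weight_nonneg in auto)
qed

lemma weight_at_top: "filterlim \<omega> at_top at_top"
proof (rule filterlim_at_top_mono[OF _ weight_ge_ln])
  show "filterlim (\<lambda>t::real. ln (1 + t\<^sup>2)) at_top at_top"
    by (intro filterlim_compose[OF ln_at_top] filterlim_tendsto_add_at_top[OF tendsto_const]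
        filterlim_pow_at_top filterlim_ident) simp
qed

lemma weight_doubling_iterated: "\<exists>K\<ge>1. \<forall>t\<ge>0. \<omega> (2 ^ n * t) \<le> K * (\<omega> t + 1)"
proof (induction n)
  case 0
  then show ?case by (intro exI[of _ 1]) auto
next
  case (Suc n)
  then obtain K where K: "K \<ge> 1" "\<And>t. t \<ge> 0 \<Longrightarrow> \<omega> (2 ^ n * t) \<le> K * (\<omega> t + 1)" by blast
  from w obtain L where L: "L \<ge> 1" "\<And>t. t \<ge> 0 \<Longrightarrow> \<omega> (2 * t) \<le> L * (\<omega> t + 1)"
    unfolding weight_def by blast
  have "\<omega> (2 ^ Suc n * t) \<le> (2 * (L * K)) * (\<omega> t + 1)" if t: "t \<ge> 0" for t
  proof -
    have "1 \<le> K * (\<omega> t + 1)" using mult_mono[of 1 K 1 "\<omega> t + 1"] K weight_nonneg[OF t] by simp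
    have "\<omega> (2 ^ Suc n * t) \<le> L * (\<omega> (2 ^ n * t) + 1)" using L(2)[of "2 ^ n * t"] t by (simp add: mult.assoc)
    also have "\<dots> \<le> L * (K * (\<omega> t + 1) + K * (\<omega> t + 1))"
      using L K(2)[OF t] \<open>1 \<le> K * (\<omega> t + 1)\<close> by (intro mult_left_mono add_mono) auto
    finally show ?thesis by (simp add: algebra_simps)
  qed
  moreover have "2 * (L * K) \<ge> 1" using mult_mono[of 1 L 1 K] L K by simp
  ultimately show ?case by blast
qed

text \<open>By condition (\<beta>) the integral of \<open>g\<close> over \<open>{t<..2 * t}\<close>
  tends to 0. For \<open>t \<ge> 1\<close> the integrand is at least
  \<open>\<omega> t / (5 * t\<^sup>2)\<close> on this interval, so the integral is at least
  \<open>\<omega> t / (5 * t)\<close>.\<close>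

lemma weight_sublinear:
  assumes "\<epsilon> > 0"
  shows "\<forall>\<^sub>F t in at_top. \<omega> t \<le> \<epsilon> * t"
proof -
  define g where "g t = \<omega> t / (1 + t\<^sup>2)" for t
  define I where "I t = (LINT s:{0..t}|lborel. g s)" for t
  have int: "set_integrable lborel {0..} g"
    using w by (simp add: weight_def g_def[abs_def])
  have I: "(I \<longlongrightarrow> (LINT s:{0..}|lborel. g s)) at_top"
    unfolding I_def using int by (intro tendsto_set_lebesgue_integral_at_top) auto
  have I2: "((\<lambda>t. I (2 * t)) \<longlongrightarrow> (LINT s:{0..}|lborel. g s)) at_top"
    by (intro filterlim_compose[OF I] filterlim_tendsto_pos_mult_at_top[OF tendsto_const] filterlim_ident) simp
  have "((\<lambda>t. I (2 * t) - I t) \<longlongrightarrow> 0) at_top" using tendsto_diff[OF I2 I] by simp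
  then have "\<forall>\<^sub>F t in at_top. I (2 * t) - I t < \<epsilon> / 5"
    using assms by (intro order_tendstoD) auto
  then show ?thesis using eventually_ge_at_top[of 1]
  proof eventually_elim
    case (elim t)
    have int': "set_integrable lborel A g" if "A \<subseteq> {0..}" "A \<in> sets lborel" for A
      using set_integrable_subset[OF int] that by auto
    have "t * (\<omega> t / (5 * t\<^sup>2)) = (LINT s:{t<..2 * t}|lborel. \<omega> t / (5 * t\<^sup>2))"
      using elim by (simp add: set_lebesgue_integral_def)
    also have "\<dots> \<le> (LINT s:{t<..2 * t}|lborel. g s)"
    proof (rule set_integral_mono)
      show "set_integrable lborel {t<..2 * t} (\<lambda>s. \<omega> t / (5 * t\<^sup>2))"
        unfolding set_integrable_def
        by (intro integrable_scaleR_left integrable_real_indicator) (use elim in auto)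
      show "set_integrable lborel {t<..2 * t} g" using elim by (intro int') auto
      fix s assume s: "s \<in> {t<..2 * t}"
      then have "s\<^sup>2 \<le> (2 * t)\<^sup>2" using elim by (intro power_mono) auto
      moreover have "1 \<le> t\<^sup>2" using elim by simp
      ultimately have "1 + s\<^sup>2 \<le> 5 * t\<^sup>2" by (simp add: power_mult_distrib)
      then show "\<omega> t / (5 * t\<^sup>2) \<le> g s"
        unfolding g_def using s elim
        by (intro frac_le weight_mono weight_nonneg) (auto intro: add_pos_nonneg)
    qed
    also have "\<dots> = I (2 * t) - I t"
    proof -
      have "{0..2 * t} = {0..t} \<union> {t<..2 * t}" using elim by auto
      moreover have "(LINT s:{0..t} \<union> {t<..2 * t}|lborel. g s) = I t + (LINT s:{t<..2 * t}|lborel. g s)"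
        unfolding I_def using elim by (intro set_integral_Un int') auto
      ultimately show ?thesis by (simp add: I_def)
    qed
    also have "\<dots> \<le> \<epsilon> / 5" using elim by simp
    finally show ?case using elim by (simp add: power2_eq_square field_simps)
  qed
qed

text \<open>\<open>p\<close> is the slope of a supporting line of the convex function
  \<open>\<omega> (exp t)\<close> at \<open>ln R\<close>. Evaluating the line at
  \<open>ln R - 1\<close> and using monotonicity gives \<open>p \<ge> 0\<close>; evaluating it at
  \<open>ln R + 1\<close>, with \<open>exp 1 \<le> 3\<close>, gives the upper bound.\<close>

lemma weight_subgradient:
  assumes R: "R > 0"
  obtains p where "0 \<le> p" "p \<le> \<omega> (3 * R)" "\<And>x. x > 0 \<Longrightarrow> \<omega> R + p * (ln x - ln R) \<le> \<omega> x"
proof -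
  let ?\<phi> = "\<lambda>t. \<omega> (exp t)"
  have "convex_on UNIV ?\<phi>" using w by (simp add: weight_def)
  then obtain p where p: "\<And>v. ?\<phi> (ln R) + p * (v - ln R) \<le> ?\<phi> v"
    using convex_le_Inf_differential[of UNIV ?\<phi> "ln R"] by (metis UNIV_I interior_UNIV)
  show thesis
  proof
    have "\<omega> R - p \<le> \<omega> (exp (ln R - 1))" using p[of "ln R - 1"] R by simp
    also have "\<dots> \<le> \<omega> R" using R by (intro weight_mono) (auto simp: exp_diff field_simps)
    finally show "0 \<le> p" by simp
    have "\<omega> R + p \<le> \<omega> (exp (ln R + 1))" using p[of "ln R + 1"] R by simp
    also have "\<dots> \<le> \<omega> (3 * R)" using R exp_le by (intro weight_mono) (auto simp: exp_add)
    finally show "p \<le> \<omega> (3 * R)" using weight_nonneg[of R] R by simp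
    show "\<omega> R + p * (ln x - ln R) \<le> \<omega> x" if "x > 0" for x
      using p[of "ln x"] R that by simp
  qed
qed

end

text \<open>For \<open>s = x / t \<ge> 1\<close>, the integrand in (\<epsilon>) at
  \<open>y = t\<close> is at least \<open>\<omega> x / (4 * s\<^sup>2)\<close> on
  \<open>{s..2 * s}\<close>, so \<open>\<omega> x / (4 * s)\<close> is bounded by the right-hand
  side of (\<epsilon>). What matters later is that \<open>C\<close> does not depend on the scale
  \<open>t\<close>.\<close>

lemma strong_weight_growth:
  assumes "strong_weight \<omega>"
  shows "\<exists>C\<ge>1. \<forall>t>0. \<forall>x\<ge>0. \<omega> x \<le> C * (\<omega> t + 1) * (1 + x / t)"
proof -
  have w: "weight \<omega>" using assms by (simp add: strong_weight_def)
  obtain C where C: "C \<ge> 1"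
    "\<And>y. y > 0 \<Longrightarrow> (\<integral>\<^sup>+ t\<in>{1..}. ennreal (\<omega> (y * t) / t\<^sup>2) \<partial>lborel) \<le> ennreal (C * \<omega> y + C)"
    using assms unfolding strong_weight_def by blast
  have "\<omega> x \<le> 4 * C * (\<omega> t + 1) * (1 + x / t)" if t: "t > 0" and x: "x \<ge> 0" for t x
  proof (cases "x \<le> t")
    case True
    have "\<omega> x \<le> 1 * (\<omega> t + 1) * 1" using weight_mono[OF w x True] by simp
    also have "\<dots> \<le> 4 * C * (\<omega> t + 1) * (1 + x / t)"
      using C t x weight_nonneg[OF w, of t] by (intro mult_mono) auto
    finally show ?thesis .
  next
    case False
    define s where "s = x / t"
    have s: "s \<ge> 1" "t * s = x" using False t by (auto simp: s_def)
    have "ennreal (\<omega> x / (4 * s\<^sup>2) * s) = (\<integral>\<^sup>+ r\<in>{s..2 * s}. ennreal (\<omega> x / (4 * s\<^sup>2)) \<partial>lborel)"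
    proof -
      have "0 \<le> \<omega> x / (4 * s\<^sup>2)" "emeasure lborel {s..2 * s} = ennreal s"
        using s weight_nonneg[OF w x] by auto
      with s show ?thesis
        by (simp only: nn_integral_cmult_indicator sets_lborel atLeastAtMost_borel ennreal_mult)
    qed
    also have "\<dots> \<le> (\<integral>\<^sup>+ r\<in>{1..}. ennreal (\<omega> (t * r) / r\<^sup>2) \<partial>lborel)"
    proof (rule nn_integral_mono)
      fix r
      have "\<omega> x / (4 * s\<^sup>2) \<le> \<omega> (t * r) / r\<^sup>2" if r: "r \<in> {s..2 * s}"
      proof (intro frac_le weight_nonneg[OF w] weight_mono[OF w])
        show "r\<^sup>2 \<le> 4 * s\<^sup>2" using r s power_mono[of r "2 * s" 2] by (simp add: power_mult_distrib)
        show "x \<le> t * r" using r s t by (metis atLeastAtMost_iff less_imp_le mult_left_mono)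
        show "0 \<le> t * r" "0 < r\<^sup>2" using r s t by auto
      qed (use x in auto)
      then show "ennreal (\<omega> x / (4 * s\<^sup>2)) * indicator {s..2 * s} r
          \<le> ennreal (\<omega> (t * r) / r\<^sup>2) * indicator {1..} r"
        using s by (auto simp: indicator_def intro!: ennreal_leI)
    qed
    also have "\<dots> \<le> ennreal (C * \<omega> t + C)" using C t by simp
    finally have "\<omega> x / (4 * s\<^sup>2) * s \<le> C * \<omega> t + C"
      using C weight_nonneg[OF w, of t] t by (subst (asm) ennreal_le_iff) auto
    then have "\<omega> x \<le> 4 * C * (\<omega> t + 1) * s" using s by (simp add: power2_eq_square field_simps)
    also have "\<dots> \<le> 4 * C * (\<omega> t + 1) * (1 + s)"
      using C weight_nonneg[OF w, of t] t by (intro mult_left_mono) auto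
    finally show ?thesis by (simp add: s_def)
  qed
  moreover have "4 * C \<ge> 1" using C by simp
  ultimately show ?thesis by blast
qed

section \<open>Functions in Gelfand-Shilov spaces\<close>

lemma integrable_inverse_1_plus_square_lborel: "integrable lborel (\<lambda>x::real. 1 / (1 + x\<^sup>2))"
  using integrable_inverse_1_plus_square by (simp add: set_integrable_def einterval_eq inverse_eq_divide)

text \<open>Condition (\<gamma>) in multiplicative form, with \<open>D\<close> absorbing the small
  arguments. It supplies integrable majorants and lets exponential decay in the weight absorb
  powers.\<close>

lemma weight_exp_bound:
  assumes "weight \<omega>"
  obtains D where "D \<ge> 1" "\<And>x. 1 + x\<^sup>2 \<le> D * exp (\<omega> \<bar>x\<bar>)"
proof -
  obtain T where T: "\<And>t. t \<ge> T \<Longrightarrow> ln (1 + t\<^sup>2) \<le> \<omega> t"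
    using weight_ge_ln[OF assms] by (auto simp: eventually_at_top_linorder)
  have "1 + x\<^sup>2 \<le> (1 + T\<^sup>2) * exp (\<omega> \<bar>x\<bar>)" for x
  proof (cases "\<bar>x\<bar> \<ge> T")
    case True
    have pos: "0 < 1 + x\<^sup>2" by (intro add_pos_nonneg) auto
    have "exp (ln (1 + x\<^sup>2)) \<le> exp (\<omega> \<bar>x\<bar>)" using T[OF True] by simp
    then have "1 * (1 + x\<^sup>2) \<le> (1 + T\<^sup>2) * exp (\<omega> \<bar>x\<bar>)"
      using pos by (intro mult_mono) auto
    then show ?thesis by simp
  next
    case False
    then have "x\<^sup>2 \<le> T\<^sup>2" by (simp flip: abs_le_square_iff)
    moreover have "1 \<le> exp (\<omega> \<bar>x\<bar>)" using weight_nonneg[OF assms] by simp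
    ultimately have "(1 + x\<^sup>2) * 1 \<le> (1 + T\<^sup>2) * exp (\<omega> \<bar>x\<bar>)" by (intro mult_mono) auto
    then show ?thesis by simp
  qed
  then show thesis by (intro that[of "1 + T\<^sup>2"]) auto
qed

lemma integrable_of_weight_bound:
  fixes f :: "real \<Rightarrow> complex"
  assumes w: "weight \<omega>" and f: "f \<in> borel_measurable lborel" and K: "\<And>x. norm (f x) * exp (\<omega> \<bar>x\<bar>) \<le> K"
  shows "integrable lborel f"
proof -
  obtain D where D: "D \<ge> 1" "\<And>x. 1 + x\<^sup>2 \<le> D * exp (\<omega> \<bar>x\<bar>)" using weight_exp_bound[OF w] by blast
  have "norm (f x) \<le> K * D * (1 / (1 + x\<^sup>2))" for x
  proof -
    have "norm (f x) * (1 + x\<^sup>2) \<le> norm (f x) * (D * exp (\<omega> \<bar>x\<bar>))"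
      by (intro mult_left_mono D) auto
    also have "\<dots> \<le> K * D" using mult_right_mono[OF K[of x], of D] D(1) by (simp add: mult_ac)
    finally show ?thesis by (simp add: pos_le_divide_eq add_pos_nonneg)
  qed
  then have "norm (f x) \<le> norm (K * D * (1 / (1 + x\<^sup>2)))" for x
    unfolding real_norm_def by (rule order_trans[OF _ abs_ge_self])
  then show ?thesis
    using f by (intro Bochner_Integration.integrable_bound[OF
        integrable_mult_right[OF integrable_inverse_1_plus_square_lborel, of "K * D"]] AE_I2)
qed

lemma C_infinity_imp_continuous: "C_infinity f \<Longrightarrow> continuous_on A f"
  unfolding C_infinity_def iter_deriv_def
  by (metis continuous_at_imp_continuous_on differentiable_imp_continuous_within funpow_0)

lemma gelfand_shilovI:
  assumes w: "weight \<omega>" and f: "C_infinity f" "C_infinity (fourier f)"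
    and K: "\<And>l j. l > 0 \<Longrightarrow> \<exists>K. \<forall>x. norm (iter_deriv j f x) * exp (l * \<omega> \<bar>x\<bar>) \<le> K"
    and K': "\<And>l j. l > 0 \<Longrightarrow> \<exists>K. \<forall>x. norm (iter_deriv j (fourier f) x) * exp (l * \<omega> \<bar>x\<bar>) \<le> K"
  shows "f \<in> gelfand_shilov \<omega>"
proof -
  obtain B where "\<And>x. norm (f x) * exp (\<omega> \<bar>x\<bar>) \<le> B"
    using K[of 1 0] by (auto simp: iter_deriv_def)
  moreover have "f \<in> borel_measurable lborel"
    using C_infinity_imp_continuous[OF f(1)] by (simp add: borel_measurable_continuous_onI)
  ultimately have "integrable lborel f" by (intro integrable_of_weight_bound[OF w])
  moreover have "gs_seminorm \<omega> l j f < \<infinity>" if "l > 0" for l j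
  proof -
    from K[OF that] obtain B where B: "\<And>x. norm (iter_deriv j f x) * exp (l * \<omega> \<bar>x\<bar>) \<le> B" by blast
    from K'[OF that] obtain B' where B': "\<And>x. norm (iter_deriv j (fourier f) x) * exp (l * \<omega> \<bar>x\<bar>) \<le> B'" by blast
    have "gs_seminorm \<omega> l j f \<le> max (ennreal B) (ennreal B')"
      unfolding gs_seminorm_def using B B' by (intro max.mono SUP_least ennreal_leI) auto
    also have "\<dots> < \<infinity>" by simp
    finally show ?thesis .
  qed
  ultimately show ?thesis using f by (simp add: gelfand_shilov_def)
qed

lemma gelfand_shilov_bounds:
  assumes "f \<in> gelfand_shilov \<omega>" and l: "l > 0"
  shows "\<exists>K. \<forall>x. norm (f x) * exp (l * \<omega> \<bar>x\<bar>) \<le> K"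
    and "\<exists>K. \<forall>x. norm (fourier f x) * exp (l * \<omega> \<bar>x\<bar>) \<le> K"
proof -
  let ?S = "gs_seminorm \<omega> l 0 f"
  have fin: "?S < \<infinity>" using assms by (auto simp: gelfand_shilov_def)
  have "ennreal (norm (f x) * exp (l * \<omega> \<bar>x\<bar>)) \<le> ?S"
    "ennreal (norm (fourier f x) * exp (l * \<omega> \<bar>x\<bar>)) \<le> ?S" for x
    unfolding gs_seminorm_def iter_deriv_def
    by (rule max.coboundedI1, rule SUP_upper2[of x], simp, simp,
        rule max.coboundedI2, rule SUP_upper2[of x], simp, simp)
  then have "norm (f x) * exp (l * \<omega> \<bar>x\<bar>) \<le> enn2real ?S"
    "norm (fourier f x) * exp (l * \<omega> \<bar>x\<bar>) \<le> enn2real ?S" for x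
    using fin by (auto simp flip: ennreal_le_iff[OF enn2real_nonneg])
  then show "\<exists>K. \<forall>x. norm (f x) * exp (l * \<omega> \<bar>x\<bar>) \<le> K"
    "\<exists>K. \<forall>x. norm (fourier f x) * exp (l * \<omega> \<bar>x\<bar>) \<le> K" by blast+
qed

text \<open>The order \<open>m\<close> is chosen through the slope of the convex function \<open>t \<mapsto> \<sigma> (exp t)\<close> at
  \<open>ln R\<close>, so that \<open>\<xi> ^ m * exp (- \<sigma> \<xi>)\<close> is essentially maximal at \<open>\<xi> = R\<close>.\<close>

lemma gelfand_shilov_derivative_bound:
  assumes w: "weight \<sigma>" and g: "g \<in> gelfand_shilov \<sigma>"
  obtains G :: "nat \<Rightarrow> real \<Rightarrow> real" and K :: real
  where "G 0 = (\<lambda>x. Re (g x))"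
    and "\<And>i x. (G i has_real_derivative G (Suc i) x) (at x)"
    and "\<And>R. R \<ge> 1 \<Longrightarrow> \<exists>m. real m \<le> \<sigma> (3 * R) + 1 \<and> (\<forall>x. \<bar>G m x\<bar> \<le> K * R ^ m * exp (- \<sigma> R))"
proof -
  have gint: "integrable lborel g" and gc: "continuous_on UNIV g"
    and fc: "continuous_on UNIV (fourier g)"
    using g C_infinity_imp_continuous by (auto simp: gelfand_shilov_def)
  have [measurable]: "fourier g \<in> borel_measurable borel"
    using fc by (rule borel_measurable_continuous_onI)
  obtain D where D: "D \<ge> 1" "\<And>x. 1 + x\<^sup>2 \<le> D * exp (\<sigma> \<bar>x\<bar>)" using weight_exp_bound[OF w] by blast
  define u where "u i \<xi> = (\<i> * of_real \<xi>) ^ i * fourier g \<xi>" for i \<xi>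
  have norm_u: "norm (u i \<xi>) = \<bar>\<xi>\<bar> ^ i * norm (fourier g \<xi>)" for i \<xi>
    by (simp add: u_def norm_mult norm_power)
  have u_int: "integrable lborel (u i)" for i
  proof -
    \<comment> \<open>Of the \<open>i + 1\<close> factors
      \<open>exp (\<sigma> \<bar>x\<bar>)\<close>, \<open>i\<close> absorb the power
      \<open>\<bar>x\<bar> ^ i\<close> and one is left for integrability.\<close>
    obtain B where B: "\<And>x. norm (fourier g x) * exp ((real i + 1) * \<sigma> \<bar>x\<bar>) \<le> B"
      using gelfand_shilov_bounds(2)[OF g, of "real i + 1"] by auto
    have "norm (u i x) * exp (\<sigma> \<bar>x\<bar>) \<le> D ^ i * B" for x
    proof -
      have "\<bar>x\<bar> \<le> 1 + x\<^sup>2"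
        using zero_le_power2[of "\<bar>x\<bar> - 1"] abs_ge_zero[of x] by (simp add: power2_eq_square algebra_simps)
      also note D(2)
      finally have "\<bar>x\<bar> ^ i \<le> D ^ i * exp (i * \<sigma> \<bar>x\<bar>)"
        using power_mono[of "\<bar>x\<bar>" "D * exp (\<sigma> \<bar>x\<bar>)" i] by (simp add: power_mult_distrib exp_of_nat_mult)
      then have "norm (u i x) * exp (\<sigma> \<bar>x\<bar>) \<le> (D ^ i * exp (i * \<sigma> \<bar>x\<bar>)) * norm (fourier g x) * exp (\<sigma> \<bar>x\<bar>)"
        unfolding norm_u by (intro mult_right_mono) auto
      also have "\<dots> = D ^ i * (norm (fourier g x) * exp ((real i + 1) * \<sigma> \<bar>x\<bar>))"
        by (simp add: algebra_simps exp_add)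
      also have "\<dots> \<le> D ^ i * B" using B D by (intro mult_left_mono) auto
      finally show ?thesis .
    qed
    moreover have "u i \<in> borel_measurable lborel" unfolding u_def by measurable
    ultimately show ?thesis by (intro integrable_of_weight_bound[OF w])
  qed
  define h where "h i x = (LINT \<xi>|lborel. u i \<xi> * iexp (\<xi> * x))" for i x
  have dh: "(h i has_vector_derivative h (Suc i) x) (at x)" for i x
  proof -
    have "(\<lambda>\<xi>. of_real \<xi> * u i \<xi>) = (\<lambda>\<xi>. - \<i> * u (Suc i) \<xi>)"
      by (simp add: u_def fun_eq_iff mult.assoc)
    then have "integrable lborel (\<lambda>\<xi>. of_real \<xi> * u i \<xi>)"
      using integrable_mult_right[OF u_int[of "Suc i"], of "- \<i>"] by (simp only:)
    from has_vector_derivative_inverse_fourier[OF u_int this, of x]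
    show ?thesis unfolding h_def u_def by (simp add: mult_ac)
  qed
  obtain Bg where Bg: "\<And>x. norm (g x) * exp (1 * \<sigma> \<bar>x\<bar>) \<le> Bg"
    using gelfand_shilov_bounds(1)[OF g, of 1] by auto
  have g_le: "norm (g x) \<le> Bg" for x
    using Bg[of x] mult_left_mono[of 1 "exp (\<sigma> \<bar>x\<bar>)" "norm (g x)"] weight_nonneg[OF w, of "\<bar>x\<bar>"] by simp
  have "integrable lborel (fourier g)" using u_int[of 0] by (simp add: u_def[abs_def])
  from fourier_inversion[OF gint gc g_le this]
  have inv: "g x = h 0 x / (2 * pi)" for x
    unfolding h_def u_def power_0 mult_1_left .
  define G where "G i x = Re (h i x) / (2 * pi)" for i x
  \<comment> \<open>Of the three factors \<open>exp (\<sigma> \<bar>x\<bar>)\<close>, one is spent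
    on maximizing \<open>\<bar>x\<bar> ^ m * exp (- \<sigma> \<bar>x\<bar>)\<close> and two on
    \<open>(1 + \<bar>x\<bar>) * (1 + x\<^sup>2)\<close>.\<close>
  obtain B where B: "\<And>x. norm (fourier g x) * exp (3 * \<sigma> \<bar>x\<bar>) \<le> B"
    using gelfand_shilov_bounds(2)[OF g, of 3] by auto
  have B0: "B \<ge> 0" using order_trans[OF _ B[of 0]] by simp
  define J where "J = (LINT x::real|lborel. 1 / (1 + x\<^sup>2))"
  show thesis
  proof
    show "G 0 = (\<lambda>x. Re (g x))" by (auto simp: G_def inv)
    show "(G i has_real_derivative G (Suc i) x) (at x)" for i x
    proof -
      have "((\<lambda>x. Re (h i x)) has_vector_derivative Re (h (Suc i) x)) (at x)"
        using dh by (rule bounded_linear.has_vector_derivative[OF bounded_linear_Re])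
      then have "((\<lambda>x. Re (h i x)) has_real_derivative Re (h (Suc i) x)) (at x)"
        by (simp add: has_real_derivative_iff_has_vector_derivative)
      then show ?thesis unfolding G_def by (rule DERIV_cdivide)
    qed
    fix R :: real assume R: "R \<ge> 1"
    obtain p where p: "0 \<le> p" "p \<le> \<sigma> (3 * R)" "\<And>x. x > 0 \<Longrightarrow> \<sigma> R + p * (ln x - ln R) \<le> \<sigma> x"
      using weight_subgradient[OF w, of R] R by auto
    \<comment> \<open>The slope \<open>p\<close> is the ideal exponent. Rounding it up by at most 1
      costs the factor \<open>1 + \<bar>x\<bar>\<close> in \<open>key\<close>, and
      \<open>m > 0\<close> makes the left side of \<open>key\<close> vanish at
      \<open>x = 0\<close>.\<close>
    define m where "m = nat \<lfloor>p\<rfloor> + 1"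
    have m: "p \<le> m" "m \<le> p + 1" "m > 0" using p(1) unfolding m_def by linarith+
    have key: "\<bar>x\<bar> ^ m * exp (- \<sigma> \<bar>x\<bar>) \<le> R ^ m * exp (- \<sigma> R) * (1 + \<bar>x\<bar>)" for x
    proof (cases "x = 0")
      case True
      then show ?thesis using m R by (simp add: power_0_left)
    next
      case False
      \<comment> \<open>The subgradient inequality is exactly \<open>key\<close> with exponent
        \<open>p\<close> and without the last factor; this bounds what the excess
        \<open>m - p\<close> adds, which is harmful only for
        \<open>\<bar>x\<bar> > R\<close>.\<close>
      have "(m - p) * (ln \<bar>x\<bar> - ln R) \<le> ln (1 + \<bar>x\<bar>)"
      proof (cases "\<bar>x\<bar> \<le> R")
        case True
        then have "(m - p) * (ln \<bar>x\<bar> - ln R) \<le> 0"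
          using m False R by (intro mult_nonneg_nonpos) auto
        also have "0 \<le> ln (1 + \<bar>x\<bar>)" by simp
        finally show ?thesis .
      next
        case x: False
        then have "(m - p) * (ln \<bar>x\<bar> - ln R) \<le> 1 * (ln \<bar>x\<bar> - ln R)"
          using m False R by (intro mult_right_mono) auto
        also have "\<dots> \<le> ln (1 + \<bar>x\<bar>)"
        proof -
          have "ln \<bar>x\<bar> \<le> ln (1 + \<bar>x\<bar>)" using False by (subst ln_le_cancel_iff) auto
          then show ?thesis using ln_ge_zero[OF R] by simp
        qed
        finally show ?thesis .
      qed
      with p(3)[of "\<bar>x\<bar>"] False
      have "m * ln \<bar>x\<bar> - \<sigma> \<bar>x\<bar> \<le> m * ln R - \<sigma> R + ln (1 + \<bar>x\<bar>)" by (simp add: algebra_simps)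
      then have "exp (m * ln \<bar>x\<bar> - \<sigma> \<bar>x\<bar>) \<le> exp (m * ln R - \<sigma> R + ln (1 + \<bar>x\<bar>))" by simp
      then show ?thesis
        using False R by (simp add: exp_diff exp_add exp_of_nat_mult exp_minus field_simps)
    qed
    have u_le: "norm (u m x) \<le> 2 * B * D\<^sup>2 * R ^ m * exp (- \<sigma> R) * (1 / (1 + x\<^sup>2))" for x
    proof -
      have "0 < 1 + x\<^sup>2" by (intro add_pos_nonneg) auto
      have "\<bar>x\<bar> \<le> 1 + x\<^sup>2"
        using zero_le_power2[of "\<bar>x\<bar> - 1"] abs_ge_zero[of x] by (simp add: power2_eq_square algebra_simps)
      then have "1 + \<bar>x\<bar> \<le> 1 + (1 + x\<^sup>2)" by (rule add_left_mono)
      moreover have "1 + (1 + x\<^sup>2) \<le> 2 * (1 + x\<^sup>2)" by simp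
      ultimately have "1 + \<bar>x\<bar> \<le> 2 * (1 + x\<^sup>2)" by (rule order_trans)
      then have "(1 + \<bar>x\<bar>) * (1 + x\<^sup>2) \<le> 2 * (1 + x\<^sup>2) * (1 + x\<^sup>2)"
        using \<open>0 < 1 + x\<^sup>2\<close> by (rule mult_right_mono[OF _ less_imp_le])
      also have "\<dots> \<le> 2 * (D * exp (\<sigma> \<bar>x\<bar>)) * (D * exp (\<sigma> \<bar>x\<bar>))"
        using D(1) by (intro mult_mono D order_refl) auto
      also have "\<dots> = 2 * D\<^sup>2 * (exp (\<sigma> \<bar>x\<bar>) * exp (\<sigma> \<bar>x\<bar>))"
        by (simp only: power2_eq_square mult_ac)
      also have "exp (\<sigma> \<bar>x\<bar>) * exp (\<sigma> \<bar>x\<bar>) = exp (2 * \<sigma> \<bar>x\<bar>)" by (simp flip: exp_add)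
      finally have *: "(1 + \<bar>x\<bar>) * (1 + x\<^sup>2) \<le> 2 * D\<^sup>2 * exp (2 * \<sigma> \<bar>x\<bar>)" .
      have "norm (u m x) * (1 + x\<^sup>2)
          = (\<bar>x\<bar> ^ m * exp (- \<sigma> \<bar>x\<bar>)) * (norm (fourier g x) * exp (\<sigma> \<bar>x\<bar>)) * (1 + x\<^sup>2)"
        by (simp add: norm_u exp_minus)
      also have "\<dots> \<le> (R ^ m * exp (- \<sigma> R) * (1 + \<bar>x\<bar>)) * (norm (fourier g x) * exp (\<sigma> \<bar>x\<bar>)) * (1 + x\<^sup>2)"
        by (intro mult_right_mono key) auto
      also have "\<dots> = (R ^ m * exp (- \<sigma> R) * (norm (fourier g x) * exp (\<sigma> \<bar>x\<bar>))) * ((1 + \<bar>x\<bar>) * (1 + x\<^sup>2))"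
        by simp
      also have "\<dots> \<le> (R ^ m * exp (- \<sigma> R) * (norm (fourier g x) * exp (\<sigma> \<bar>x\<bar>))) * (2 * D\<^sup>2 * exp (2 * \<sigma> \<bar>x\<bar>))"
        using R by (intro mult_left_mono *) auto
      also have "\<dots> = (2 * D\<^sup>2 * R ^ m * exp (- \<sigma> R)) * (norm (fourier g x) * exp (3 * \<sigma> \<bar>x\<bar>))"
      proof -
        have "exp (\<sigma> \<bar>x\<bar>) * exp (2 * \<sigma> \<bar>x\<bar>) = exp (3 * \<sigma> \<bar>x\<bar>)" by (simp flip: exp_add)
        then show ?thesis by (simp add: mult_ac)
      qed
      also have "\<dots> \<le> (2 * D\<^sup>2 * R ^ m * exp (- \<sigma> R)) * B"
        using R by (intro mult_left_mono B) auto
      finally show ?thesis using \<open>0 < 1 + x\<^sup>2\<close> by (simp add: pos_le_divide_eq mult_ac)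
    qed
    have "\<bar>G m x\<bar> \<le> (2 * B * D\<^sup>2 * J) * R ^ m * exp (- \<sigma> R)" for x
    proof -
      have "norm (h m x) \<le> (LINT \<xi>|lborel. norm (u m \<xi> * iexp (\<xi> * x)))" unfolding h_def by simp
      also have "\<dots> \<le> (LINT \<xi>|lborel. 2 * B * D\<^sup>2 * R ^ m * exp (- \<sigma> R) * (1 / (1 + \<xi>\<^sup>2)))"
        using u_int[of m] u_le
        by (intro integral_mono integrable_mult_right integrable_inverse_1_plus_square_lborel)
          (auto simp: norm_mult intro!: integrable_norm)
      also have "\<dots> = 2 * B * D\<^sup>2 * R ^ m * exp (- \<sigma> R) * J"
        unfolding J_def by (rule integral_mult_right_zero)
      finally have *: "norm (h m x) \<le> 2 * B * D\<^sup>2 * R ^ m * exp (- \<sigma> R) * J" .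
      have "\<bar>G m x\<bar> = \<bar>Re (h m x)\<bar> / (2 * pi)" by (simp add: G_def)
      also have "\<dots> \<le> norm (h m x) / 1" using pi_gt3 by (intro frac_le abs_Re_le_cmod) auto
      finally show ?thesis using * by (simp add: mult_ac)
    qed
    moreover have "real m \<le> \<sigma> (3 * R) + 1" using m p by simp
    ultimately show "\<exists>m. real m \<le> \<sigma> (3 * R) + 1 \<and> (\<forall>x. \<bar>G m x\<bar> \<le> (2 * B * D\<^sup>2 * J) * R ^ m * exp (- \<sigma> R))"
      by blast
  qed
qed

section \<open>Composition with a steep function\<close>

text \<open>If \<open>k > 1\<close>, the derivative of \<open>\<psi> powr (1 - k)\<close> is
  eventually at most \<open>- (k - 1)\<close>, so \<open>h\<close> is nonincreasing from
  \<open>X\<close> on. But \<open>h x \<ge> (k - 1) * x\<close>, which exceeds \<open>h X\<close> at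
  \<open>Y\<close>.\<close>

lemma deriv_powr_imp_exponent_le_1:
  fixes \<psi> :: "real \<Rightarrow> real"
  assumes diff: "\<And>x. (\<psi> has_real_derivative deriv \<psi> x) (at x)"
    and lim: "filterlim \<psi> at_top at_top"
    and ge: "\<forall>\<^sub>F x in at_top. deriv \<psi> x \<ge> \<psi> x powr k"
  shows "k \<le> 1"
proof (rule ccontr)
  assume "\<not> k \<le> 1"
  then have k: "k > 1" by simp
  have "\<forall>\<^sub>F x in at_top. \<psi> x \<ge> 1" using lim by (simp add: filterlim_at_top)
  with ge have "\<forall>\<^sub>F x in at_top. \<psi> x \<ge> 1 \<and> deriv \<psi> x \<ge> \<psi> x powr k" by eventually_elim auto
  then obtain X where X: "\<And>x. x \<ge> X \<Longrightarrow> \<psi> x \<ge> 1 \<and> deriv \<psi> x \<ge> \<psi> x powr k"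
    by (auto simp: eventually_at_top_linorder)
  define h where "h x = \<psi> x powr (1 - k) + (k - 1) * x" for x
  define Y where "Y = max X (h X / (k - 1) + 1)"
  have "h Y \<le> h X"
  proof (rule DERIV_nonpos_imp_nonincreasing[where f = h])
    show "X \<le> Y" by (simp add: Y_def)
    fix x assume "X \<le> x" "x \<le> Y"
    with X have x: "\<psi> x \<ge> 1" "deriv \<psi> x \<ge> \<psi> x powr k" by auto
    have "(h has_real_derivative (1 - k) * \<psi> x powr (1 - k - 1) * deriv \<psi> x + (k - 1)) (at x)"
      unfolding h_def using DERIV_fun_powr[OF diff[of x], of "1 - k"] x
      by (intro DERIV_add DERIV_cmult_Id) auto
    moreover have "\<psi> x powr (1 - k - 1) * deriv \<psi> x \<ge> \<psi> x powr (1 - k - 1) * \<psi> x powr k"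
      using x by (intro mult_left_mono) auto
    then have "\<psi> x powr (1 - k - 1) * deriv \<psi> x \<ge> 1"
      using x by (simp flip: powr_add)
    then have "(1 - k) * (\<psi> x powr (1 - k - 1) * deriv \<psi> x) \<le> (1 - k) * 1"
      using k by (intro mult_left_mono_neg) auto
    ultimately show "\<exists>y. (h has_real_derivative y) (at x) \<and> y \<le> 0" by (intro exI conjI) (auto simp: mult.assoc)
  qed
  moreover have "h Y \<ge> (k - 1) * Y" by (simp add: h_def)
  moreover have "(k - 1) * Y \<ge> (k - 1) * (h X / (k - 1) + 1)"
    using k by (intro mult_left_mono) (auto simp: Y_def)
  then have "(k - 1) * Y > h X" using k by (simp add: distrib_left)
  ultimately show False by simp
qed

text \<open>The multiples of \<open>pi / t\<close> in \<open>[t, 2 * t]\<close>, where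
  \<open>F\<close> alternates in sign, are pulled back by \<psi> to points \<open>x i\<close>. By
  the mean value theorem neighbours are at most \<delta> apart, so \<open>m\<close> zeros of
  \<open>G 0\<close> lie within \<open>m * \<delta>\<close> of \<open>x 0\<close>, and the
  interpolation estimate bounds \<open>G 0 (x 0)\<close>.\<close>

lemma oscillation_bound:
  fixes \<psi> F :: "real \<Rightarrow> real" and G :: "nat \<Rightarrow> real \<Rightarrow> real"
  assumes diff: "\<And>x. (\<psi> has_real_derivative deriv \<psi> x) (at x)"
    and lim: "filterlim \<psi> at_top at_top"
    and ge: "\<And>x. x \<ge> X \<Longrightarrow> \<psi> x \<ge> 1 \<and> deriv \<psi> x \<ge> \<psi> x powr k"
    and k: "k > 0"
    and G0: "G 0 = (\<lambda>x. F (\<psi> x))"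
    and der: "\<And>i x. (G i has_real_derivative G (Suc i) x) (at x)"
    and t: "t \<ge> 1" "t \<ge> \<psi> X"
    and A: "A > 0"
      "\<And>l::nat. t \<le> pi * l / t \<Longrightarrow> pi * l / t \<le> 2 * t \<Longrightarrow> (- 1) ^ l * F (pi * l / t) \<ge> A"
    and m: "pi * (m + 1) \<le> t\<^sup>2"
    and B: "\<And>x. \<bar>G m x\<bar> \<le> B"
  shows "A \<le> (16 / t powr (k + 1)) ^ m * B"
proof -
  \<comment> \<open>\<open>y 0\<close> is the first multiple of \<open>pi / t\<close> not below
    \<open>t\<close>. Rounding up may lose one step, hence \<open>m + 1\<close> in the hypothesis
    that keeps \<open>y m\<close> below \<open>2 * t\<close>.\<close>
  define L where "L = nat \<lceil>t\<^sup>2 / pi\<rceil>"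
  have L: "t\<^sup>2 / pi \<le> L" "L \<le> t\<^sup>2 / pi + 1" using t by (auto simp: L_def of_nat_ceiling)
  define y where "y i = pi * real (L + i) / t" for i
  have y_ge: "t \<le> y i" for i
  proof -
    have "t\<^sup>2 \<le> pi * L" using L by (simp add: field_simps)
    also have "\<dots> \<le> pi * real (L + i)" by simp
    finally show ?thesis using t by (simp add: y_def field_simps power2_eq_square)
  qed
  have y_le: "y i \<le> 2 * t" if "i \<le> m" for i
  proof -
    have "pi * real (L + i) \<le> pi * (t\<^sup>2 / pi + 1 + m)" using L that by (intro mult_left_mono) auto
    also have "\<dots> = t\<^sup>2 + pi * (m + 1)" by (simp add: algebra_simps)
    also have "\<dots> \<le> t * (2 * t)" using m by (simp add: power2_eq_square algebra_simps)
    finally show ?thesis using t by (simp add: y_def divide_le_eq mult.commute)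
  qed
  have cont: "isCont \<psi> x" for x using diff[of x] by (rule DERIV_isCont)
  have mono: "\<psi> a \<le> \<psi> b" if "X \<le> a" "a \<le> b" for a b
  proof (rule DERIV_nonneg_imp_nondecreasing[OF that(2), where f = \<psi>])
    fix x assume "a \<le> x" "x \<le> b"
    then have "deriv \<psi> x \<ge> \<psi> x powr k" using ge[of x] that by auto
    then have "0 \<le> deriv \<psi> x" by (rule order_trans[OF powr_ge_zero])
    then show "\<exists>y. (\<psi> has_real_derivative y) (at x) \<and> 0 \<le> y" using diff by blast
  qed
  have "\<exists>x\<ge>X. \<psi> x = y i" for i
  proof -
    have "\<forall>\<^sub>F x in at_top. \<psi> x \<ge> y i" using lim by (simp add: filterlim_at_top)
    then obtain b where b: "\<And>x. x \<ge> b \<Longrightarrow> \<psi> x \<ge> y i" by (auto simp: eventually_at_top_linorder)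
    have "\<exists>x. X \<le> x \<and> x \<le> max X b \<and> \<psi> x = y i"
      using b[of "max X b"] y_ge[of i] t cont by (intro IVT) auto
    then show ?thesis by blast
  qed
  then obtain x where x: "\<And>i. x i \<ge> X" "\<And>i. \<psi> (x i) = y i" by metis
  define \<delta> where "\<delta> = pi / t powr (k + 1)"
  have x_less: "x i < x (Suc i)" for i
  proof (rule ccontr)
    assume "\<not> x i < x (Suc i)"
    then have "\<psi> (x (Suc i)) \<le> \<psi> (x i)" using x by (intro mono) auto
    then have "pi * real (L + Suc i) / t \<le> pi * real (L + i) / t" by (simp only: x y_def)
    moreover have "pi * real (L + i) / t < pi * real (L + Suc i) / t"
      using t by (intro divide_strict_right_mono mult_strict_left_mono) auto
    ultimately show False by simp
  qed
  have step: "x (Suc i) - x i \<le> \<delta>" for i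
  proof -
    obtain c where c: "x i < c" "c < x (Suc i)" "\<psi> (x (Suc i)) - \<psi> (x i) = (x (Suc i) - x i) * deriv \<psi> c"
      using MVT2[OF x_less[of i], of \<psi> "deriv \<psi>"] diff by blast
    have "t \<le> \<psi> c" using mono[of "x i" c] c x y_ge[of i] by fastforce
    then have "t powr k \<le> \<psi> c powr k" using t k by (intro powr_mono2) auto
    also have "\<dots> \<le> deriv \<psi> c" using ge[of c] c x(1)[of i] by auto
    finally have "(x (Suc i) - x i) * t powr k \<le> \<psi> (x (Suc i)) - \<psi> (x i)"
      unfolding c(3) using x_less[of i] by (intro mult_left_mono) auto
    also have "\<dots> = pi / t" using t by (simp add: x y_def field_simps)
    finally show ?thesis using t by (simp add: \<delta>_def powr_add field_simps)
  qed
  have x_le: "x i \<le> x 0 + i * \<delta>" for i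
  proof (induction i)
    case (Suc i)
    then show ?case using step[of i] by (simp add: algebra_simps)
  qed simp
  have sgn: "(- 1) ^ (L + i) * G 0 (x i) \<ge> A" if "i \<le> m" for i
    using A(2)[of "L + i"] y_ge[of i] y_le[OF that] by (simp add: G0 x y_def)
  have G_cont: "isCont (G 0) x" for x using der[of 0 x] by (rule DERIV_isCont)
  have "\<exists>z. x i < z \<and> z < x (Suc i) \<and> G 0 z = 0" if i: "i < m" for i
  proof -
    have s: "(- 1) ^ (L + i) * G 0 (x i) > 0" "(- 1) ^ (L + i) * G 0 (x (Suc i)) < 0"
      using sgn[of i] sgn[of "Suc i"] i A(1) by auto
    have "\<exists>z\<ge>x i. z \<le> x (Suc i) \<and> - ((- 1) ^ (L + i) * G 0 z) = 0"
      using s x_less[of i] G_cont by (intro IVT) (auto intro!: continuous_intros)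
    then obtain z where "x i \<le> z" "z \<le> x (Suc i)" "G 0 z = 0" by auto
    moreover from this s have "z \<noteq> x i" "z \<noteq> x (Suc i)" by auto
    ultimately show ?thesis by (intro exI[of _ z]) auto
  qed
  then obtain z where z: "\<And>i. i < m \<Longrightarrow> x i < z i \<and> z i < x (Suc i) \<and> G 0 (z i) = 0" by metis
  have d0: "\<delta> \<ge> 0" by (simp add: \<delta>_def)
  have "\<bar>G 0 (x 0)\<bar> \<le> (m * \<delta>) ^ m / fact m * B"
  proof (rule norm_le_of_zeros[where z = z and H = G and y = "x 0"])
    show "z i < z (Suc i)" if "Suc i < m" for i using z[of i] z[of "Suc i"] that by simp
    have "x 0 \<le> x i" for i using x_less by (induction i) (auto intro: order_trans less_imp_le)
    then show "x 0 < z i" if "i < m" for i using z[OF that] order_le_less_trans by blast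
    show "z i - x 0 \<le> m * \<delta>" if "i < m" for i
    proof -
      have "z i - x 0 \<le> Suc i * \<delta>" using z[OF that] x_le[of "Suc i"] by simp
      also have "\<dots> \<le> m * \<delta>" using that d0 by (intro mult_right_mono) auto
      finally show ?thesis .
    qed
  qed (use der z B in auto)
  moreover have "A \<le> \<bar>G 0 (x 0)\<bar>"
    using sgn[of 0] abs_ge_self[of "(- 1) ^ L * G 0 (x 0)"] by (simp add: abs_mult power_abs)
  moreover have "(m * \<delta>) ^ m / fact m \<le> (16 / t powr (k + 1)) ^ m"
  proof -
    \<comment> \<open>The bound 12 is rounded up to 16, a power of 2, to suit the iterated doubling
      condition.\<close>
    have "exp 1 * pi \<le> (3 * 4 :: real)" using exp_le pi_less_4 by (intro mult_mono) auto
    then have "exp 1 * \<delta> \<le> 16 / t powr (k + 1)" using t by (simp add: \<delta>_def divide_right_mono)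
    then have *: "(exp 1 * \<delta>) ^ m \<le> (16 / t powr (k + 1)) ^ m" using d0 by (intro power_mono) auto
    have "(m * \<delta>) ^ m / fact m = real m ^ m * \<delta> ^ m / fact m" by (simp add: power_mult_distrib)
    also have "\<dots> \<le> exp (real m) * fact m * \<delta> ^ m / fact m"
      using d0 power_le_exp_fact[of m] by (intro divide_right_mono mult_right_mono) auto
    also have "\<dots> = (exp 1 * \<delta>) ^ m" by (simp add: power_mult_distrib flip: exp_of_nat_mult)
    finally show ?thesis using * by simp
  qed
  moreover have "B \<ge> 0" using B[of 0] by simp
  ultimately show ?thesis by (meson mult_right_mono order_trans)
qed

text \<open>Each term may be taken as large as its predecessor demands: \<open>P\<close> holds the
  conditions on a single term, \<open>Q\<close> those on two neighbours.\<close>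

lemma dependent_eventually_choice:
  assumes P: "\<And>n. \<forall>\<^sub>F t in at_top. P n t" and Q: "\<And>n s. \<forall>\<^sub>F t::real in at_top. Q n s t"
  obtains t where "\<And>n. P n (t n)" "\<And>n. Q n (t n) (t (Suc n))"
proof -
  have "\<exists>t. \<forall>n. P n (t n) \<and> Q n (t n) (t (Suc n))"
  proof (rule dependent_nat_choice)
    show "\<exists>t. P 0 t" using eventually_happens'[OF _ P] by auto
    show "\<exists>t. P (Suc n) t \<and> Q n s t" for s n
      using eventually_happens'[OF _ eventually_conj[OF P Q]] by auto
  qed
  then show thesis using that by blast
qed

section \<open>The oscillating series\<close>

text \<open>The modulation by \<open>t\<close> becomes a translation by \<open>t\<close>. The zero
  centre and zero frequency are written out so that both sides match the summands of
  \<open>gaussian_series\<close>.\<close>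

lemma fourier_gaussian:
  fixes a t \<xi> :: real
  assumes "a > 0"
  shows "fourier (\<lambda>x. exp (- of_real a * (of_real x - of_real 0)\<^sup>2 + \<i> * of_real t * of_real x)) \<xi>
    = complex_of_real (sqrt (pi / a)) * exp (- of_real (1 / (4 * a)) * (of_real \<xi> - of_real t)\<^sup>2 + \<i> * of_real 0 * of_real \<xi>)"
proof -
  have "fourier (\<lambda>x. exp (- of_real a * (of_real x - of_real 0)\<^sup>2 + \<i> * of_real t * of_real x)) \<xi>
    = (LINT x|lborel. of_real (exp (- a * x\<^sup>2)) * iexp ((t - \<xi>) * x))"
    unfolding fourier_def
    by (intro Bochner_Integration.integral_cong refl)
      (simp add: algebra_simps flip: exp_add exp_of_real)
  also have "\<dots> = of_real (sqrt (pi / a)) * of_real (exp (- (t - \<xi>)\<^sup>2 / (4 * a)))"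
    using gaussian_fourier[OF assms, of "t - \<xi>"] by simp
  also have "(t - \<xi>)\<^sup>2 = (\<xi> - t)\<^sup>2" by (simp add: power2_commute)
  finally show ?thesis by (simp flip: exp_of_real)
qed

lemma norm_exp_gaussian:
  "norm (exp (- complex_of_real a * (of_real x - of_real s)\<^sup>2 + \<i> * of_real t * of_real x)) = exp (- a * (x - s)\<^sup>2)"
  by (simp add: power2_eq_square)

text \<open>Sum and integral may be exchanged because the \<open>L\<^sup>1\<close> norms of the
  summands, \<open>\<bar>c n\<bar> * sqrt (pi / a n)\<close>, are summable by
  \<open>ca\<close>.\<close>

lemma fourier_gaussian_series:
  fixes c a t M :: "nat \<Rightarrow> real"
  assumes a: "\<And>n. a n > 0" and c: "\<And>n. \<bar>c n\<bar> \<le> exp (M n - n * M n)"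
    and ca: "\<And>n. \<bar>c n * sqrt (pi / a n)\<bar> \<le> exp (M n - n * M n)" and M: "\<And>n. M n \<ge> 1"
  shows "fourier (\<lambda>x. \<Sum>n. c n * exp (- of_real (a n) * (of_real x - of_real 0)\<^sup>2 + \<i> * of_real (t n) * of_real x))
    = (\<lambda>\<xi>. \<Sum>n. (c n * sqrt (pi / a n)) * exp (- of_real (1 / (4 * a n)) * (of_real \<xi> - of_real (t n))\<^sup>2 + \<i> * of_real 0 * of_real \<xi>))"
proof
  fix \<xi>
  define h where "h n x = exp (- complex_of_real (a n) * (of_real x - of_real 0)\<^sup>2 + \<i> * of_real (t n) * of_real x)" for n x
  define e where "e x = exp (- \<i> * complex_of_real (x * \<xi>))" for x
  have norm_e: "norm (e x) = 1" for x by (simp add: e_def)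
  have norm_h: "norm (h n x) = exp (- a n * x\<^sup>2)" for n x
    unfolding h_def norm_exp_gaussian by simp
  have S: "summable (\<lambda>n. exp (M n - n * M n))"
    using summable_exp_linear[of M 1, OF M] by (simp add: algebra_simps)
  have summ: "summable (\<lambda>n. norm (c n * h n x))" for x
  proof (rule summable_comparison_test'[OF S, of 0])
    fix n
    have "\<bar>c n\<bar> * norm (h n x) \<le> exp (M n - n * M n) * 1"
      using c a[of n] by (intro mult_mono) (auto simp: norm_h)
    then show "norm (norm (c n * h n x)) \<le> exp (M n - n * M n)" by (simp add: norm_mult)
  qed
  have int_norm: "integrable lborel (\<lambda>x. norm (c n * h n x * e x))" for n
    using integrable_gaussian[OF a[of n]] by (simp add: norm_mult norm_h norm_e)
  have int: "integrable lborel (\<lambda>x. c n * h n x * e x)" for n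
  proof (rule Bochner_Integration.integrable_bound[OF int_norm[of n]])
    show "(\<lambda>x. c n * h n x * e x) \<in> borel_measurable lborel"
      unfolding h_def e_def measurable_lborel2 by (intro borel_measurable_continuous_onI continuous_intros)
  qed simp
  have "fourier (\<lambda>x. \<Sum>n. c n * h n x) \<xi> = (LINT x|lborel. (\<Sum>n. c n * h n x * e x))"
    unfolding fourier_def e_def[symmetric]
    by (intro Bochner_Integration.integral_cong refl suminf_mult2 summable_norm_cancel[OF summ])
  also have "\<dots> = (\<Sum>n. LINT x|lborel. c n * h n x * e x)"
  proof (rule integral_suminf[OF int])
    show "AE x in lborel. summable (\<lambda>n. norm (c n * h n x * e x))"
      using summ by (intro AE_I2) (simp add: norm_mult norm_e)
    show "summable (\<lambda>n. LINT x|lborel. norm (c n * h n x * e x))"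
    proof (rule summable_comparison_test'[OF S, of 0])
      fix n
      have "(LINT x|lborel. norm (c n * h n x * e x)) = \<bar>c n\<bar> * sqrt (pi / a n)"
        using gaussian_integral[OF a[of n]] by (simp add: norm_mult norm_h norm_e)
      then show "norm (LINT x|lborel. norm (c n * h n x * e x)) \<le> exp (M n - n * M n)"
        using ca[of n] a[of n] by (simp add: abs_mult)
    qed
  qed
  also have "\<dots> = (\<Sum>n. c n * fourier (h n) \<xi>)"
    unfolding fourier_def e_def[symmetric] mult.assoc by simp
  finally have "fourier (\<lambda>x. \<Sum>n. c n * h n x) \<xi> = (\<Sum>n. c n * fourier (h n) \<xi>)" .
  moreover have "fourier (h n) \<xi> = of_real (sqrt (pi / a n)) *
      exp (- of_real (1 / (4 * a n)) * (of_real \<xi> - of_real (t n))\<^sup>2 + \<i> * of_real 0 * of_real \<xi>)" for n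
    unfolding h_def by (rule fourier_gaussian[OF a])
  ultimately show "fourier (\<lambda>x. \<Sum>n. c n * exp (- of_real (a n) * (of_real x - of_real 0)\<^sup>2 + \<i> * of_real (t n) * of_real x)) \<xi>
    = (\<Sum>n. (c n * sqrt (pi / a n)) * exp (- of_real (1 / (4 * a n)) * (of_real \<xi> - of_real (t n))\<^sup>2 + \<i> * of_real 0 * of_real \<xi>))"
    by (simp only: h_def of_real_mult mult.assoc)
qed

text \<open>The assumption \<open>sparse\<close> controls the summands before the \<open>n\<close>-th one, and \<open>gap\<close> those after it.\<close>

lemma dominant_oscillation:
  fixes t M :: "nat \<Rightarrow> real" and l :: nat
  defines "F \<equiv> \<lambda>x. \<Sum>j. exp (- (j * M j)) * exp (- (M j / (t j)\<^sup>2) * x\<^sup>2) * cos (t j * x)"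
  assumes t: "\<And>n. t n \<ge> 1" "\<And>n. t n \<le> t (Suc n)" and M: "\<And>n. M n \<ge> 1" "\<And>n. M n \<le> M (Suc n)"
    and gap: "\<And>n. (n + 4) * M n + 4 \<le> M (Suc n)"
    and sparse: "\<And>n. (n + 5) * M (Suc n) + (n + 5) \<le> (t (Suc n) / t n)\<^sup>2"
    and x: "t n \<le> pi * l / t n" "pi * l / t n \<le> 2 * t n"
  shows "exp (- ((n + 4) * M n)) / 2 \<le> (- 1) ^ l * F (pi * l / t n)"
proof -
  define x where "x = pi * l / t n"
  \<comment> \<open>A lower bound for the amplitude of the \<open>n\<close>-th summand:
    \<open>n * M n\<close> comes from its coefficient, and \<open>x \<le> 2 * t n\<close> costs at
    most \<open>4 * M n\<close> in the Gaussian.\<close>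
  define E where "E = exp (- ((n + 4) * M n))"
  define b where "b j = exp (- (j * M j)) * exp (- (M j / (t j)\<^sup>2) * x\<^sup>2)" for j
  \<comment> \<open>Every other summand is at most its share \<open>w j\<close> of \<open>E\<close>.
    The shares add up to 1/4, so more than \<open>E / 2\<close> survives.\<close>
  define w :: "nat \<Rightarrow> real" where "w j = (1 / 2) ^ (j + 3)" for j
  have tmono: "i \<le> j \<Longrightarrow> t i \<le> t j" for i j using t(2) by (rule lift_Suc_mono_le)
  have Mmono: "i \<le> j \<Longrightarrow> M i \<le> M j" for i j using M(2) by (rule lift_Suc_mono_le)
  have x_sq: "(t n)\<^sup>2 \<le> x\<^sup>2" "x\<^sup>2 \<le> 4 * (t n)\<^sup>2"
  proof -
    show "(t n)\<^sup>2 \<le> x\<^sup>2" using x t(1)[of n] unfolding x_def by (intro power_mono) auto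
    have "x\<^sup>2 \<le> (2 * t n)\<^sup>2" using x t(1)[of n] unfolding x_def by (intro power_mono) auto
    then show "x\<^sup>2 \<le> 4 * (t n)\<^sup>2" by (simp add: power_mult_distrib)
  qed
  have exp_half: "exp (- real i) \<le> (1 / 2) ^ i" for i :: nat
  proof -
    have "exp (- real i) = exp (- 1) ^ i" by (simp flip: exp_of_nat_mult)
    also have "\<dots> \<le> (1 / 2) ^ i"
    proof (rule power_mono)
      have "2 \<le> exp (1::real)" using exp_ge_add_one_self[of 1] by simp
      then show "exp (- 1) \<le> 1 / (2::real)" by (simp add: exp_minus field_simps)
    qed simp
    finally show ?thesis .
  qed
  have b_le: "b j \<le> E * w j" if "j \<noteq> n" for j
  proof (cases "j < n")
    case True
    then obtain i where i: "n = Suc i" "j \<le> i" by (cases n) auto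
    have "b j \<le> 1 * exp (- (M j / (t j)\<^sup>2) * x\<^sup>2)"
      unfolding b_def using M(1)[of j] by (intro mult_right_mono) auto
    also have "\<dots> \<le> 1 * exp (- ((n + 4) * M n + (n + 4)))"
    proof -
      \<comment> \<open>An earlier summand is small because \<open>x \<ge> t n\<close> lies far out
        in its Gaussian. As \<open>n = Suc i\<close>, the \<open>i + 5\<close> in
        \<open>sparse\<close> is \<open>n + 4\<close>.\<close>
      have "(n + 4) * M n + (n + 4) \<le> (t n / t i)\<^sup>2" using sparse[of i] i by (simp add: add.commute)
      also have "\<dots> \<le> (t n / t j)\<^sup>2"
        using tmono[OF i(2)] t(1)[of j] t(1)[of i] t(1)[of n] by (intro power_mono divide_left_mono) auto
      also have "\<dots> = 1 * ((t n)\<^sup>2 / (t j)\<^sup>2)" by (simp add: power_divide)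
      also have "\<dots> \<le> M j * (x\<^sup>2 / (t j)\<^sup>2)"
        using M(1)[of j] x_sq by (intro mult_mono divide_right_mono) auto
      finally show ?thesis by simp
    qed
    also have "\<dots> = E * exp (- real (n + 4))" by (simp add: E_def algebra_simps flip: exp_add)
    also have "\<dots> \<le> E * (1 / 2) ^ (n + 4)" using exp_half[of "n + 4"] unfolding E_def by (intro mult_left_mono) auto
    also have "\<dots> \<le> E * w j"
      unfolding w_def E_def using True by (intro mult_left_mono power_decreasing) auto
    finally show ?thesis .
  next
    case False
    with that obtain i where i: "j = Suc i" "n \<le> i" by (cases j) auto
    \<comment> \<open>A later summand is small by its coefficient: of the \<open>j = i + 1\<close>
      copies of \<open>M j\<close>, one covers \<open>(n + 4) * M n + 4\<close> and the others
      contribute at least \<open>i\<close>, where \<open>i + 4 = j + 3\<close>.\<close>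
    have "(n + 4) * M n + 4 \<le> M j" using gap[of n] Mmono[of "Suc n" j] i by simp
    moreover have "real i * 1 \<le> i * M j" using M(1)[of j] by (intro mult_left_mono) auto
    ultimately have "(n + 4) * M n + (j + 3) \<le> j * M j" using i by (simp add: algebra_simps)
    moreover have "b j \<le> exp (- (j * M j)) * 1"
      unfolding b_def using M(1)[of j] by (intro mult_left_mono) auto
    ultimately have "b j \<le> exp (- ((n + 4) * M n + (j + 3)))" by (smt (verit) exp_le_cancel_iff)
    also have "\<dots> = E * exp (- real (j + 3))" by (simp add: E_def algebra_simps flip: exp_add)
    also have "\<dots> \<le> E * w j" using exp_half[of "j + 3"] unfolding E_def w_def by (intro mult_left_mono) auto
    finally show ?thesis .
  qed
  have b_n: "E \<le> b n"
  proof -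
    have "M n / (t n)\<^sup>2 * x\<^sup>2 \<le> M n / (t n)\<^sup>2 * (4 * (t n)\<^sup>2)"
      using x_sq M(1)[of n] by (intro mult_left_mono) auto
    also have "\<dots> = 4 * M n" using t(1)[of n] by simp
    finally show ?thesis by (simp add: E_def b_def algebra_simps flip: exp_add)
  qed
  have w_sums: "w sums (1 / 4)"
  proof -
    have "(\<lambda>j. (1 / 8) * (1 / 2) ^ j) sums ((1 / 8) * (1 / (1 - 1 / 2 :: real)))"
      by (intro sums_mult geometric_sums) simp
    moreover have "w = (\<lambda>j. (1 / 8) * (1 / 2) ^ j)"
      by (simp add: w_def fun_eq_iff power_add power3_eq_cube)
    ultimately show ?thesis by simp
  qed
  have b0: "b j \<ge> 0" for j by (simp add: b_def)
  have w0: "w j \<ge> 0" for j by (simp add: w_def)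
  have E0: "E > 0" by (simp add: E_def)
  define d where "d j = (- 1) ^ l * (b j * cos (t j * x))" for j
  have abs_d: "\<bar>d j\<bar> \<le> b j" for j
    using b0[of j] mult_left_le[of "\<bar>cos (t j * x)\<bar>" "b j"] by (simp add: d_def abs_mult power_abs)
  have "t n * x = pi * l" using t(1)[of n] by (simp add: x_def)
  then have "cos (t n * x) = (- 1) ^ l" using cos_npi2[of l] by simp
  then have d_n: "d n = b n" by (simp add: d_def flip: power_add mult_2)
  have sum_b: "summable b"
  proof (rule summable_comparison_test_ev)
    show "summable (\<lambda>j. E * w j)" using w_sums by (intro summable_mult) (auto simp: sums_iff)
    show "\<forall>\<^sub>F j in sequentially. norm (b j) \<le> E * w j"
      using eventually_gt_at_top[of n] by eventually_elim (use b_le b0 in auto)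
  qed
  have sum_d: "summable d" by (rule summable_comparison_test'[OF sum_b, of 0]) (use abs_d in auto)
  have lower: "(\<lambda>j. (if j = n then E else 0) - E * w j) sums (E - E * (1 / 4))"
    by (intro sums_diff sums_mult w_sums sums_single)
  have "E - E * (1 / 4) \<le> suminf d"
    unfolding sums_unique[OF lower]
  proof (intro suminf_le sum_d)
    show "summable (\<lambda>j. (if j = n then E else 0) - E * w j)" using lower by (simp add: sums_iff)
    show "(if j = n then E else 0) - E * w j \<le> d j" for j
    proof (cases "j = n")
      case True
      have "E - E * w n \<le> E" using E0 w0[of n] by simp
      then show ?thesis using True d_n b_n by simp
    next
      case False
      then show ?thesis using b_le[of j] abs_d[of j] by simp
    qed
  qed
  also have "suminf d = (- 1) ^ l * F x"
  proof -
    have "summable (\<lambda>j. (- 1) ^ l * d j)" using sum_d by (rule summable_mult)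
    then have "summable (\<lambda>j. b j * cos (t j * x))" by (simp add: d_def flip: mult.assoc power_add mult_2)
    from suminf_mult[OF this, of "(- 1) ^ l"] show ?thesis unfolding d_def F_def b_def by simp
  qed
  finally have "E / 2 \<le> (- 1) ^ l * F x" using E0 by simp
  then show ?thesis by (simp add: E_def x_def)
qed

text \<open>\<open>gaussian_series\<close> is applied to \<open>f\<close>, with centre 0 and
  frequency \<open>t n\<close>, and to its transform, with centre \<open>t n\<close> and frequency
  0. In both cases the weight grows at most linearly, by \<open>strong_weight_growth\<close>, and
  loses against the quadratic exponent uniformly in \<open>n\<close>.\<close>

lemma sparse_gaussian_series_mem_gelfand_shilov:
  fixes t M :: "nat \<Rightarrow> real" and \<omega> :: "real \<Rightarrow> real"
  defines "M \<equiv> \<lambda>n. \<omega> (t n) + 1"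
  assumes strong: "strong_weight \<omega>"
    and t: "\<And>n. t n \<ge> 2" and Mt: "\<And>n. M n \<le> t n" and ln: "\<And>n. ln (1 + (t n)\<^sup>2) \<le> \<omega> (t n)"
  shows "(\<lambda>x. \<Sum>n. exp (- (n * M n)) *
      exp (- of_real (M n / (t n)\<^sup>2) * (of_real x - of_real 0)\<^sup>2 + \<i> * of_real (t n) * of_real x)) \<in> gelfand_shilov \<omega>"
    (is "?f \<in> _")
proof -
  have w: "weight \<omega>" using strong by (simp add: strong_weight_def)
  obtain C where C: "C \<ge> 1" "\<And>t x. t > 0 \<Longrightarrow> x \<ge> 0 \<Longrightarrow> \<omega> x \<le> C * (\<omega> t + 1) * (1 + x / t)"
    using strong_weight_growth[OF strong] by blast
  define a where "a n = M n / (t n)\<^sup>2" for n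
  define c where "c n = exp (- (real n * M n))" for n
  have t0: "t n > 0" for n using t[of n] by simp
  have M: "M n \<ge> 1" for n using weight_nonneg[OF w, of "t n"] t0[of n] by (simp add: M_def)
  have a0: "a n > 0" for n using M[of n] t0[of n] by (simp add: a_def)
  \<comment> \<open>One factor \<open>exp (M n)\<close> thus absorbs the polynomial factors in
    \<open>t n\<close> from the Cauchy estimates and from \<open>sqrt (pi / a n)\<close>.\<close>
  have tM: "1 + (t n)\<^sup>2 \<le> exp (M n)" for n
  proof -
    have "0 < 1 + (t n)\<^sup>2" by (intro add_pos_nonneg) auto
    then have "1 + (t n)\<^sup>2 = exp (ln (1 + (t n)\<^sup>2))" by simp
    also have "\<dots> \<le> exp (M n)" using ln[of n] by (simp add: M_def del: exp_ln)
    finally show ?thesis .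
  qed
  have t_sq: "2 * t n \<le> (t n)\<^sup>2" for n using mult_right_mono[OF t[of n], of "t n"] t0[of n] by (simp add: power2_eq_square)
  have c_le: "\<bar>c n\<bar> \<le> exp (M n - n * M n)" for n using M[of n] by (simp add: c_def)
  have ca_le: "\<bar>c n * sqrt (pi / a n)\<bar> \<le> exp (M n - n * M n)" for n
  proof -
    have "sqrt (pi / a n) \<le> sqrt (4 * (t n)\<^sup>2)"
    proof (rule real_sqrt_le_mono)
      have "pi / a n = (pi / M n) * (t n)\<^sup>2" by (simp add: a_def)
      also have "\<dots> \<le> 4 * (t n)\<^sup>2"
        using M[of n] pi_less_4 frac_le[of 4 pi 1 "M n"] by (intro mult_right_mono) auto
      finally show "pi / a n \<le> 4 * (t n)\<^sup>2" .
    qed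
    also have "\<dots> = 2 * t n" using t0[of n] by (simp add: real_sqrt_mult)
    also have "\<dots> \<le> exp (M n)" using t_sq[of n] tM[of n] by simp
    finally have "c n * sqrt (pi / a n) \<le> c n * exp (M n)" by (simp add: c_def)
    then show ?thesis using a0[of n] by (simp add: c_def abs_mult algebra_simps flip: exp_add)
  qed
  define F where "F = (\<lambda>x. \<Sum>n. c n * exp (- of_real (a n) * (of_real x - of_real 0)\<^sup>2 + \<i> * of_real (t n) * of_real x))"
  have fourier_F: "fourier F = (\<lambda>\<xi>. \<Sum>n. (c n * sqrt (pi / a n)) *
      exp (- of_real (1 / (4 * a n)) * (of_real \<xi> - of_real (t n))\<^sup>2 + \<i> * of_real 0 * of_real \<xi>))"
    unfolding F_def by (rule fourier_gaussian_series[OF a0 c_le ca_le M])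
  have growth: "l * \<omega> \<bar>x\<bar> \<le> l * C * M n * (1 + \<bar>x\<bar> / t n)" if "l > 0" for l x n
    using mult_left_mono[OF C(2)[OF t0[of n], of "\<bar>x\<bar>"], of l] that by (simp add: M_def mult_ac)
  have v: "\<exists>B. \<forall>n x. l * \<omega> \<bar>x\<bar> - a n * (x - 0)\<^sup>2 / 2 \<le> B * M n" if l: "l > 0" for l
  proof -
    define q where "q = l * C"
    have "l * \<omega> \<bar>x\<bar> - a n * (x - 0)\<^sup>2 / 2 \<le> (q + q\<^sup>2 / 2) * M n" for n x
    proof -
      define r where "r = \<bar>x\<bar> / t n"
      \<comment> \<open>In the scaled variable \<open>r\<close>, \<open>M n\<close> factors out of
        both weight bound and Gaussian exponent, and the remaining quadratic has a maximum
        independent of \<open>n\<close>.\<close>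
      have "q * (1 + r) - r\<^sup>2 / 2 \<le> q + q\<^sup>2 / 2"
        using zero_le_power2[of "r - q"] by (simp add: power2_eq_square algebra_simps)
      then have "M n * (q * (1 + r) - r\<^sup>2 / 2) \<le> M n * (q + q\<^sup>2 / 2)"
        using M[of n] by (intro mult_left_mono) auto
      moreover have "a n * (x - 0)\<^sup>2 / 2 = M n * (r\<^sup>2 / 2)" by (simp add: a_def r_def power_divide)
      ultimately show ?thesis using growth[OF l, of x n] by (simp add: q_def r_def algebra_simps)
    qed
    then show ?thesis by blast
  qed
  have v': "\<exists>B. \<forall>n x. l * \<omega> \<bar>x\<bar> - 1 / (4 * a n) * (x - t n)\<^sup>2 / 2 \<le> B * M n" if l: "l > 0" for l
  proof -
    define q where "q = l * C"
    have q: "q > 0" using l C by (simp add: q_def)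
    have "l * \<omega> \<bar>x\<bar> - 1 / (4 * a n) * (x - t n)\<^sup>2 / 2 \<le> (2 * q + 2 * q\<^sup>2) * M n" for n x
    proof -
      define d where "d = \<bar>x - t n\<bar>"
      have "\<bar>x\<bar> / t n \<le> (t n + d) / t n" using t0[of n] by (intro divide_right_mono) (auto simp: d_def)
      also have "\<dots> = 1 + d / t n" using t0[of n] by (simp add: add_divide_distrib)
      also have "d / t n \<le> d / 1" using t[of n] by (intro divide_left_mono) (auto simp: d_def)
      finally have "q * M n * (1 + \<bar>x\<bar> / t n) \<le> q * M n * (2 + d)"
        using q M[of n] by (intro mult_left_mono) auto
      moreover have "M n * (d\<^sup>2 / 8) \<le> 1 / (4 * a n) * (x - t n)\<^sup>2 / 2"
      proof -
        \<comment> \<open>Here \<open>M n \<le> t n\<close> enters: it makes the Gaussian on the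
          frequency side steep enough to beat a linear term of slope \<open>q * M n\<close>.\<close>
        have "M n \<le> (t n)\<^sup>2 / M n"
          using M[of n] Mt[of n] mult_mono[OF Mt[of n] Mt[of n]] t0[of n]
          by (simp add: pos_le_divide_eq power2_eq_square)
        then have "M n * (d\<^sup>2 / 8) \<le> (t n)\<^sup>2 / M n * (d\<^sup>2 / 8)" by (intro mult_right_mono) auto
        also have "\<dots> = 1 / (4 * a n) * (x - t n)\<^sup>2 / 2" by (simp add: a_def d_def)
        finally show ?thesis .
      qed
      moreover have "q * (2 + d) - d\<^sup>2 / 8 \<le> 2 * q + 2 * q\<^sup>2"
        using zero_le_power2[of "d - 4 * q"] by (simp add: power2_eq_square algebra_simps)
      then have "M n * (q * (2 + d) - d\<^sup>2 / 8) \<le> M n * (2 * q + 2 * q\<^sup>2)"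
        using M[of n] by (intro mult_left_mono) auto
      ultimately show ?thesis using growth[OF l, of x n] by (simp add: q_def algebra_simps)
    qed
    then show ?thesis by blast
  qed
  have ab: "1 + a n + \<bar>t n\<bar> \<le> exp (M n)" for n
  proof -
    have "a n \<le> t n / (t n)\<^sup>2" unfolding a_def using Mt by (intro divide_right_mono) auto
    also have "\<dots> \<le> 1" using t[of n] by (simp add: power2_eq_square)
    finally show ?thesis using t_sq[of n] tM[of n] t[of n] by simp
  qed
  have ab': "1 + 1 / (4 * a n) + \<bar>0\<bar> \<le> exp (M n)" for n
  proof -
    have "1 / (4 * a n) = (t n)\<^sup>2 / (4 * M n)" by (simp add: a_def)
    also have "\<dots> \<le> (t n)\<^sup>2 / 1" using M[of n] by (intro divide_left_mono) auto
    finally show ?thesis using tM[of n] by simp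
  qed
  have v0: "\<omega> \<bar>x\<bar> \<ge> 0" for x using weight_nonneg[OF w] by simp
  have a0': "0 \<le> a n" "0 \<le> 1 / (4 * a n)" for n using a0[of n] by auto
  note S = gaussian_series[OF c_le a0'(1) ab M v0 v, folded F_def]
  note S' = gaussian_series[OF ca_le a0'(2) ab' M v0 v', folded fourier_F]
  have "F \<in> gelfand_shilov \<omega>"
    by (intro gelfand_shilovI w S S')
  then show ?thesis by (simp add: F_def a_def c_def)
qed

section \<open>Asymptotic conditions and choice of the sequence\<close>

text \<open>Substituting \<open>t powr (k + 1)\<close> in the little-o relation compares
  \<open>\<omega> t\<close> with \<open>\<sigma> (16 * S)\<close>. Four doublings replace
  \<open>16 * S\<close> by \<open>S\<close> at the cost of \<open>K\<close>, which the little-o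
  constant cancels; the additive constants are absorbed as \<sigma> tends to infinity.\<close>

lemma eventually_weight_composite_le:
  fixes \<omega> \<sigma> :: "real \<Rightarrow> real" and k B :: real
  assumes k: "k > 0" and w: "weight \<sigma>"
    and small: "(\<lambda>t. \<omega> (t powr (1 / (k + 1)))) \<in> o[at_top](\<sigma>)" and B: "B > 0"
  shows "\<forall>\<^sub>F t in at_top. B * (\<omega> t + 1) \<le> \<sigma> (t powr (k + 1) / 16)"
proof -
  obtain K where K: "K \<ge> 1" "\<And>t. t \<ge> 0 \<Longrightarrow> \<sigma> (16 * t) \<le> K * (\<sigma> t + 1)"
    using weight_doubling_iterated[OF w, of 4] by auto
  have "\<forall>\<^sub>F s in at_top. norm (\<omega> (s powr (1 / (k + 1)))) \<le> 1 / (2 * B * K) * norm (\<sigma> s)"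
    using landau_o.smallD[OF small, of "1 / (2 * B * K)"] B K(1) by simp
  moreover have "filterlim (\<lambda>t::real. t powr (k + 1)) at_top at_top"
    using k by real_asymp
  ultimately have "\<forall>\<^sub>F t in at_top. norm (\<omega> ((t powr (k + 1)) powr (1 / (k + 1)))) \<le> 1 / (2 * B * K) * norm (\<sigma> (t powr (k + 1)))"
    by (rule eventually_compose_filterlim)
  moreover have "filterlim (\<lambda>t. \<sigma> (t powr (k + 1) / 16)) at_top at_top"
  proof (rule filterlim_compose[OF weight_at_top[OF w]])
    show "filterlim (\<lambda>t::real. t powr (k + 1) / 16) at_top at_top" using k by real_asymp
  qed
  then have "\<forall>\<^sub>F t in at_top. \<sigma> (t powr (k + 1) / 16) \<ge> 2 * B + 1" by (simp add: filterlim_at_top)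
  ultimately show ?thesis using eventually_gt_at_top[of 0]
  proof eventually_elim
    case (elim t)
    define S where "S = t powr (k + 1) / 16"
    have S: "S \<ge> 0" by (simp add: S_def)
    have "(t powr (k + 1)) powr (1 / (k + 1)) = t" using elim k by (simp add: powr_powr)
    with elim have "\<omega> t \<le> 1 / (2 * B * K) * norm (\<sigma> (16 * S))" by (simp add: S_def)
    also have "norm (\<sigma> (16 * S)) = \<sigma> (16 * S)" using weight_nonneg[OF w, of "16 * S"] S by simp
    also have "1 / (2 * B * K) * \<sigma> (16 * S) \<le> 1 / (2 * B * K) * (K * (\<sigma> S + 1))"
      using K(2)[OF S] B K(1) by (intro mult_left_mono) auto
    also have "\<dots> = (\<sigma> S + 1) / (2 * B)" using K(1) B by simp
    finally have "B * \<omega> t \<le> (\<sigma> S + 1) / 2" using B by (simp add: field_simps)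
    with elim show ?case by (simp add: S_def algebra_simps)
  qed
qed

text \<open>This makes room for the zeros: with \<open>R = t powr (k + 1) / 16\<close>, the order
  \<open>m \<le> \<sigma> (3 * R) + 1\<close> must fit among about \<open>t\<^sup>2 / pi\<close>
  sign changes. It does because \<sigma> is sublinear and \<open>k \<le> 1\<close> gives
  \<open>t powr (k + 1) \<le> t\<^sup>2\<close>.\<close>

lemma eventually_weight_le_square:
  assumes k: "k > 0" "k \<le> 1" and w: "weight \<sigma>"
  shows "\<forall>\<^sub>F t in at_top. pi * (\<sigma> (3 * (t powr (k + 1) / 16)) + 2) \<le> t\<^sup>2"
proof -
  have "\<forall>\<^sub>F s in at_top. \<sigma> s \<le> 1 / 3 * s" by (rule weight_sublinear[OF w]) simp
  moreover have "filterlim (\<lambda>t::real. 3 * (t powr (k + 1) / 16)) at_top at_top"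
    using k by real_asymp
  ultimately have "\<forall>\<^sub>F t in at_top. \<sigma> (3 * (t powr (k + 1) / 16)) \<le> 1 / 3 * (3 * (t powr (k + 1) / 16))"
    by (rule eventually_compose_filterlim)
  then show ?thesis using eventually_ge_at_top[of 4]
  proof eventually_elim
    case (elim t)
    have "t powr (k + 1) \<le> t powr 2" using elim k by (intro powr_mono) auto
    also have "\<dots> = t\<^sup>2" using elim by (simp add: powr_numeral)
    finally have "\<sigma> (3 * (t powr (k + 1) / 16)) + 2 \<le> t\<^sup>2 / 16 + 2" using elim by simp
    also have "\<dots> \<le> t\<^sup>2 / 4"
      using power_mono[of 4 t 2] elim by simp
    finally have "\<sigma> (3 * (t powr (k + 1) / 16)) + 2 \<le> t\<^sup>2 / 4" .
    then have "pi * (\<sigma> (3 * (t powr (k + 1) / 16)) + 2) \<le> pi * (t\<^sup>2 / 4)" by (rule mult_left_mono) simp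
    also have "\<dots> \<le> 4 * (t\<^sup>2 / 4)" using pi_less_4 by (intro mult_right_mono) auto
    finally show ?case by simp
  qed
qed

text \<open>The last condition can be met because its left side grows at most linearly in
  \<open>t (Suc n)\<close>, its right side quadratically.\<close>

lemma sparse_sequence:
  fixes \<omega> :: "real \<Rightarrow> real"
  assumes w: "weight \<omega>" and P: "\<And>n. \<forall>\<^sub>F t in at_top. P n t"
  obtains t :: "nat \<Rightarrow> real" where
    "\<And>n. t n \<ge> 2" "\<And>n. \<omega> (t n) + 1 \<le> t n" "\<And>n. ln (1 + (t n)\<^sup>2) \<le> \<omega> (t n)" "\<And>n. real n \<le> \<omega> (t n)"
    "\<And>n. P n (t n)" "\<And>n. t n \<le> t (Suc n)"
    "\<And>n. (real n + 4) * (\<omega> (t n) + 1) + 4 \<le> \<omega> (t (Suc n)) + 1"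
    "\<And>n. (real n + 5) * (\<omega> (t (Suc n)) + 1) + (real n + 5) \<le> (t (Suc n) / t n)\<^sup>2"
proof -
  have "\<forall>\<^sub>F t in at_top. \<omega> t \<le> 1 / 2 * t" by (rule weight_sublinear[OF w]) simp
  then have lin: "\<forall>\<^sub>F t in at_top. \<omega> t + 1 \<le> t"
    using eventually_ge_at_top[of 2] by eventually_elim simp
  have big: "\<forall>\<^sub>F t in at_top. B \<le> \<omega> t" for B
    using weight_at_top[OF w] by (simp add: filterlim_at_top)
  define P' where "P' n t \<longleftrightarrow> t \<ge> 2 \<and> \<omega> t + 1 \<le> t \<and> ln (1 + t\<^sup>2) \<le> \<omega> t \<and> real n \<le> \<omega> t \<and> P n t" for n t
  \<comment> \<open>\<open>Q\<close> must hold eventually for every \<open>s\<close>. At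
    \<open>s = 0\<close> the quotient \<open>t / s\<close> has the value 0 and the last inequality
    would fail, hence the guard.\<close>
  define Q where "Q n s t \<longleftrightarrow> s \<le> t \<and> (real n + 4) * (\<omega> s + 1) + 4 \<le> \<omega> t + 1 \<and>
      (s \<noteq> 0 \<longrightarrow> (real n + 5) * (\<omega> t + 1) + (real n + 5) \<le> (t / s)\<^sup>2)" for n s t
  have P': "\<forall>\<^sub>F t in at_top. P' n t" for n
    unfolding P'_def
    by (intro eventually_conj eventually_ge_at_top lin weight_ge_ln w big P)
  have Q: "\<forall>\<^sub>F t in at_top. Q n s t" for n s
    unfolding Q_def
  proof (intro eventually_conj eventually_ge_at_top)
    show "\<forall>\<^sub>F t in at_top. (real n + 4) * (\<omega> s + 1) + 4 \<le> \<omega> t + 1"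
      using big[of "(real n + 4) * (\<omega> s + 1) + 3"] by eventually_elim simp
    show "\<forall>\<^sub>F t in at_top. s \<noteq> 0 \<longrightarrow> (real n + 5) * (\<omega> t + 1) + (real n + 5) \<le> (t / s)\<^sup>2"
      using lin eventually_ge_at_top[of 1] eventually_ge_at_top[of "2 * (real n + 5) * s\<^sup>2"]
    proof eventually_elim
      case (elim t)
      have "(real n + 5) * (\<omega> t + 1) + (real n + 5) * 1 \<le> (real n + 5) * t + (real n + 5) * t"
        using elim by (intro add_mono mult_left_mono) auto
      also have "\<dots> \<le> (t / s)\<^sup>2" if "s \<noteq> 0"
      proof -
        have "2 * (real n + 5) * s\<^sup>2 * t \<le> t * t" using elim by (intro mult_right_mono) auto
        moreover have "s\<^sup>2 > 0" using that by simp
        ultimately show ?thesis by (simp add: power_divide pos_le_divide_eq power2_eq_square algebra_simps)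
      qed
      finally show ?case by simp
    qed
  qed
  obtain t where t: "\<And>n. P' n (t n)" "\<And>n. Q n (t n) (t (Suc n))"
    using dependent_eventually_choice[of P' Q, OF P' Q] by blast
  show thesis
  proof (rule that)
    fix n
    have "t n \<noteq> 0" using t(1)[of n] by (auto simp: P'_def)
    then show "(real n + 5) * (\<omega> (t (Suc n)) + 1) + (real n + 5) \<le> (t (Suc n) / t n)\<^sup>2"
      using t(2)[of n] by (simp add: Q_def)
  qed (use t in \<open>auto simp: P'_def Q_def\<close>)
qed

section \<open>The counterexample and the contradiction\<close>

theorem theorem3p5:
  fixes \<psi> \<omega> \<sigma> :: "real \<Rightarrow> real" and k :: real
  assumes "C_infinity \<psi>"
    and "filterlim \<psi> at_top at_top"
    and "k > 0"
    and "\<forall>\<^sub>F x in at_top. deriv \<psi> x \<ge> \<psi> x powr k"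
    and "strong_weight \<omega>" and "strong_weight \<sigma>"
    and "(\<lambda>t. \<omega> (t powr (1 / (k + 1)))) \<in> o[at_top](\<sigma>)"
  shows "\<exists>f \<in> gelfand_shilov \<omega>. f \<circ> \<psi> \<notin> gelfand_shilov \<sigma>"
proof -
  have w: "weight \<omega>" "weight \<sigma>" using assms by (auto simp: strong_weight_def)
  have "\<psi> differentiable at x" for x
    using assms(1) unfolding C_infinity_def iter_deriv_def by (metis funpow_0)
  then have diff: "(\<psi> has_real_derivative deriv \<psi> x) (at x)" for x
    by (metis DERIV_imp_deriv real_differentiable_def)
  have k: "k \<le> 1" by (rule deriv_powr_imp_exponent_le_1[OF diff assms(2,4)])
  have "\<forall>\<^sub>F x in at_top. \<psi> x \<ge> 1" using assms(2) by (simp add: filterlim_at_top)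
  with assms(4) have "\<forall>\<^sub>F x in at_top. \<psi> x \<ge> 1 \<and> deriv \<psi> x \<ge> \<psi> x powr k" by eventually_elim auto
  then obtain X where X: "\<And>x. x \<ge> X \<Longrightarrow> \<psi> x \<ge> 1 \<and> deriv \<psi> x \<ge> \<psi> x powr k"
    by (auto simp: eventually_at_top_linorder)
  have R1: "\<forall>\<^sub>F t in at_top. 1 \<le> t powr (k + 1) / 16"
  proof -
    have "filterlim (\<lambda>t::real. t powr (k + 1) / 16) at_top at_top"
      using assms(3) by real_asymp
    then show ?thesis unfolding filterlim_at_top by blast
  qed
  \<comment> \<open>Of the \<open>n + 5\<close> copies of \<open>\<omega> s + 1\<close>,
    \<open>n + 4\<close> pay for the amplitude of the \<open>n\<close>-th oscillation; the last one,
    at least \<open>n\<close>, makes the final bound diverge.\<close>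
  define P where "P n s \<longleftrightarrow> \<psi> X \<le> s \<and> 1 \<le> s powr (k + 1) / 16 \<and>
      pi * (\<sigma> (3 * (s powr (k + 1) / 16)) + 2) \<le> s\<^sup>2 \<and>
      (real n + 5) * (\<omega> s + 1) \<le> \<sigma> (s powr (k + 1) / 16)" for n :: nat and s
  have P: "\<forall>\<^sub>F s in at_top. P n s" for n
    unfolding P_def
    using assms(3,7) k w
    by (intro eventually_conj eventually_ge_at_top R1 eventually_weight_le_square eventually_weight_composite_le) auto
  obtain t where t: "\<And>n. t n \<ge> 2" "\<And>n. \<omega> (t n) + 1 \<le> t n" "\<And>n. ln (1 + (t n)\<^sup>2) \<le> \<omega> (t n)"
      "\<And>n. real n \<le> \<omega> (t n)"
    and P': "\<And>n. P n (t n)"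
    and tQ: "\<And>n. t n \<le> t (Suc n)"
    "\<And>n. (real n + 4) * (\<omega> (t n) + 1) + 4 \<le> \<omega> (t (Suc n)) + 1"
    "\<And>n. (real n + 5) * (\<omega> (t (Suc n)) + 1) + (real n + 5) \<le> (t (Suc n) / t n)\<^sup>2"
    using sparse_sequence[of \<omega> P, OF w(1) P] by blast
  have tP: "\<psi> X \<le> t n \<and> 1 \<le> t n powr (k + 1) / 16 \<and>
      pi * (\<sigma> (3 * (t n powr (k + 1) / 16)) + 2) \<le> (t n)\<^sup>2 \<and>
      (real n + 5) * (\<omega> (t n) + 1) \<le> \<sigma> (t n powr (k + 1) / 16)" for n
    using P'[of n] by (simp add: P_def)
  define M where "M n = \<omega> (t n) + 1" for n
  define f where "f = (\<lambda>x. \<Sum>n. exp (- (n * M n)) *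
      exp (- complex_of_real (M n / (t n)\<^sup>2) * (of_real x - of_real 0)\<^sup>2 + \<i> * of_real (t n) * of_real x))"
  have f_mem: "f \<in> gelfand_shilov \<omega>"
    unfolding f_def M_def
    by (rule sparse_gaussian_series_mem_gelfand_shilov[OF assms(5) t(1,2,3)])
  have M1: "M n \<ge> 1" for n using weight_nonneg[OF w(1), of "t n"] t(1)[of n] by (simp add: M_def)
  define F where "F x = (\<Sum>j. exp (- (j * M j)) * exp (- (M j / (t j)\<^sup>2) * x\<^sup>2) * cos (t j * x))" for x
  have Re_f: "Re (f x) = F x" for x
  proof -
    define T where "T n = exp (- (n * M n)) *
      exp (- complex_of_real (M n / (t n)\<^sup>2) * (of_real x - of_real 0)\<^sup>2 + \<i> * of_real (t n) * of_real x)" for n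
    have "summable T"
    proof (rule summable_comparison_test')
      show "summable (\<lambda>n. exp (M n * (0 - real n)))" by (rule summable_exp_linear[OF M1])
      show "norm (T n) \<le> exp (M n * (0 - real n))" if "n \<ge> 0" for n
      proof -
        have "norm (T n) = exp (- (n * M n)) * exp (- (M n / (t n)\<^sup>2) * (x - 0)\<^sup>2)"
          unfolding T_def norm_mult norm_exp_gaussian by simp
        also have "\<dots> \<le> exp (- (n * M n)) * 1"
          using M1[of n] by (intro mult_left_mono) auto
        finally show ?thesis by (simp add: mult.commute)
      qed
    qed
    then have "Re (suminf T) = (\<Sum>n. Re (T n))" by (rule bounded_linear.suminf[OF bounded_linear_Re])
    moreover have "Re (T n) = exp (- (n * M n)) * exp (- (M n / (t n)\<^sup>2) * x\<^sup>2) * cos (t n * x)" for n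
      by (simp add: T_def Re_exp power2_eq_square)
    ultimately have "Re (suminf T) = F x" by (simp only: F_def)
    then show ?thesis unfolding f_def T_def[abs_def] .
  qed
  have "f \<circ> \<psi> \<notin> gelfand_shilov \<sigma>"
  proof
    assume g: "f \<circ> \<psi> \<in> gelfand_shilov \<sigma>"
    obtain G K where G0: "G 0 = (\<lambda>x. Re ((f \<circ> \<psi>) x))"
      and G: "\<And>i x. (G i has_real_derivative G (Suc i) x) (at x)"
      and K: "\<And>R. R \<ge> 1 \<Longrightarrow> \<exists>m. real m \<le> \<sigma> (3 * R) + 1 \<and> (\<forall>x. \<bar>G m x\<bar> \<le> K * R ^ m * exp (- \<sigma> R))"
      using gelfand_shilov_derivative_bound[OF w(2) g] by blast
    \<comment> \<open>\<open>K\<close> depends only on \<open>f \<circ> \<psi>\<close> and \<sigma>,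
      so a lower bound that grows with \<open>n\<close> is contradictory.\<close>
    have K_ge: "exp (real n) / 2 \<le> K" for n
    proof -
      define R where "R = t n powr (k + 1) / 16"
      have R: "R \<ge> 1" using tP by (simp add: R_def)
      obtain m where m: "real m \<le> \<sigma> (3 * R) + 1" "\<And>x. \<bar>G m x\<bar> \<le> K * R ^ m * exp (- \<sigma> R)"
        using K[OF R] by blast
      have "exp (- ((real n + 4) * M n)) / 2 \<le> (16 / t n powr (k + 1)) ^ m * (K * R ^ m * exp (- \<sigma> R))"
      proof (rule oscillation_bound[where \<psi> = \<psi> and X = X and G = G and F = F])
        show "G 0 = (\<lambda>x. F (\<psi> x))" by (simp add: G0 Re_f)
        show "1 \<le> t n" using t(1)[of n] by simp
        show "\<psi> X \<le> t n" using tP by blast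
        show "0 < exp (- ((real n + 4) * M n)) / 2" by simp
        show "exp (- ((real n + 4) * M n)) / 2 \<le> (- 1) ^ l * F (pi * l / t n)"
          if "t n \<le> pi * l / t n" "pi * l / t n \<le> 2 * t n" for l
          unfolding F_def
        proof (rule dominant_oscillation)
          show "1 \<le> t n" for n using t(1)[of n] by simp
          show "M n \<le> M (Suc n)" for n
            unfolding M_def using t(1)[of n] tQ(1)[of n] by (intro add_right_mono weight_mono[OF w(1)]) auto
        qed (use that tQ M1 in \<open>simp_all add: M_def\<close>)
        have "pi * (real m + 1) \<le> pi * (\<sigma> (3 * R) + 2)" using m by (intro mult_left_mono) auto
        also have "\<dots> \<le> (t n)\<^sup>2" using tP unfolding R_def by blast
        finally show "pi * (real m + 1) \<le> (t n)\<^sup>2" .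
      qed (use diff assms(2,3) X G m in auto)
      \<comment> \<open>\<open>R\<close> is the reciprocal of the base in the interpolation bound,
        so the powers cancel whatever the order \<open>m\<close> is.\<close>
      also have "\<dots> = K * exp (- \<sigma> R)"
      proof -
        have "16 / t n powr (k + 1) = inverse R" by (simp add: R_def)
        then show ?thesis using R by (simp add: power_inverse)
      qed
      finally have "exp (\<sigma> R) * (exp (- ((real n + 4) * M n)) / 2) \<le> exp (\<sigma> R) * (K * exp (- \<sigma> R))"
        by (rule mult_left_mono) simp
      moreover have "exp (\<sigma> R) * (exp (- z) / 2) = exp (\<sigma> R - z) / 2" for z
        by (simp flip: exp_add)
      moreover have "exp (\<sigma> R) * (K * exp (- \<sigma> R)) = K" by (simp add: exp_minus)
      ultimately have "exp (\<sigma> R - (real n + 4) * M n) / 2 \<le> K" by (simp only:)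
      moreover have "n \<le> \<sigma> R - (real n + 4) * M n"
        using tP[of n] t(4)[of n] by (simp add: R_def M_def algebra_simps)
      then have "exp (real n) \<le> exp (\<sigma> R - (real n + 4) * M n)" by simp
      ultimately show ?thesis by linarith
    qed
    have "real n < 2 * K" for n
      using K_ge[of n] exp_ge_add_one_self[of "real n"] by linarith
    then show False using reals_Archimedean2[of "2 * K"] by (meson less_asym)
  qed
  with f_mem show ?thesis by blast
qed

end
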